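(* Given a complex Lie group $G$ and a holomorphic $G$-module $A$, $H^1_{lhm}(G,A)$ is the group of all holomorphic crossed homomorphisms from $G$ to $A$.
   Context: A holomorphic $G$-module is an abelian complex Lie group $A$ (written additively) with an action $G\times A\to A$ of $G$ by group automorphisms which is a holomorphic map. A holomorphic crossed homomorphism is a holomorphic map $c\colon G\to A$ with $c(st)=c(s)+s\cdot c(t)$ for all $s,t\in G$. Set $C^0_{lhm}(G,A)=A$, and for $n\ge 1$ let $C^n_{lhm}(G,A)$ be the group of all measurable functions $f\colon G^n\to A$ which are holomorphic in some neighbourhood of the identity of $G^n$. The coboundary $d^n\colon C^n_{lhm}(G,A)\to C^{n+1}_{lhm}(G,A)$ is $$d^nf(s_1,\dots,s_{n+1})=s_1\cdot f(s_2,\dots,s_{n+1})+\sum_{i=1}^n(-1)^i f(s_1,\dots,s_is_{i+1},\dots,s_{n+1})+(-1)^{n+1}f(s_1,\dots,s_n).$$ The groups $H^n_{lhm}(G,A)$, $n\ge 0$, are the cohomology groups of the cochain complex $\{C^n_{lhm}(G,A),d^n\}_{n\ge 0}$ (locally holomorphic measurable cohomology).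
   Formalization: As literally stated the claim fails (G = C^* acting on A = C by multiplication has H^1 = 0); what is proved is that the 1-cocycles are exactly all holomorphic crossed homomorphisms and that H^1 is this group modulo the principal crossed homomorphisms s ↦ s·a − a. *)

theory Defs
  imports "HOL-Analysis.Analysis" "HOL-Algebra.Bij" "HOL-Algebra.Coset" "HOL-Algebra.FiniteProduct"
begin

section \<open>Holomorphic functions of several variables\<close>

text \<open>The coordinate space of a finite index set \<open>I\<close> consists of the extensional functions
  from \<open>I\<close> to the complex numbers. Dimensions are index sets and not types, so that products and
  powers of manifolds can be formed, and dimension 0 is allowed.\<close>

definition coord_space :: "'i set \<Rightarrow> ('i \<Rightarrow> complex) topology" where
  "coord_space I = product_topology (\<lambda>_. euclidean) I"

text \<open>Existence of a complex-linear Frechet derivative, with matrix entries \<open>a i\<close>.\<close>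

definition complex_differentiable_at ::
    "'i set \<Rightarrow> (('i \<Rightarrow> complex) \<Rightarrow> complex) \<Rightarrow> ('i \<Rightarrow> complex) \<Rightarrow> bool" where
  "complex_differentiable_at I g p \<longleftrightarrow>
    (\<exists>a. ((\<lambda>v. cmod (g v - g p - (\<Sum>i\<in>I. a i * (v i - p i))) / L2_set (\<lambda>i. cmod (v i - p i)) I)
          \<longlongrightarrow> 0) (atin (coord_space I) p))"

text \<open>Used only for \<open>S\<close> open in the coordinate space of \<open>I\<close>.\<close>

definition holomorphic_coord ::
    "'i set \<Rightarrow> 'j set \<Rightarrow> ('i \<Rightarrow> complex) set \<Rightarrow> (('i \<Rightarrow> complex) \<Rightarrow> 'j \<Rightarrow> complex) \<Rightarrow> bool" where
  "holomorphic_coord I J S F \<longleftrightarrow>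
    (\<forall>p\<in>S. \<forall>j\<in>J. complex_differentiable_at I (\<lambda>v. F v j) p)"


section \<open>Complex manifolds\<close>

text \<open>A chart is a pair of its domain and its coordinate map. The atlas need not be maximal.\<close>

record ('a, 'i) manifold =
  mtop :: "'a topology"
  coords :: "'i set"
  atlas :: "('a set \<times> ('a \<Rightarrow> 'i \<Rightarrow> complex)) set"

definition complex_manifold :: "('a, 'i) manifold \<Rightarrow> bool" where
  "complex_manifold M \<longleftrightarrow>
    Hausdorff_space (mtop M) \<and> second_countable (mtop M) \<and> finite (coords M) \<and>
    (\<Union>(U, \<phi>)\<in>atlas M. U) = topspace (mtop M) \<and>
    (\<forall>(U, \<phi>)\<in>atlas M.
      openin (mtop M) U \<and> openin (coord_space (coords M)) (\<phi> ` U) \<and>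
      homeomorphic_map (subtopology (mtop M) U)
        (subtopology (coord_space (coords M)) (\<phi> ` U)) \<phi>) \<and>
    (\<forall>(U, \<phi>)\<in>atlas M. \<forall>(V, \<psi>)\<in>atlas M.
      holomorphic_coord (coords M) (coords M) (\<phi> ` (U \<inter> V)) (\<psi> \<circ> inv_into U \<phi>))"

definition holomorphic_map_on ::
    "'a set \<Rightarrow> ('a, 'i) manifold \<Rightarrow> ('b, 'j) manifold \<Rightarrow> ('a \<Rightarrow> 'b) \<Rightarrow> bool" where
  "holomorphic_map_on W M N f \<longleftrightarrow>
    openin (mtop M) W \<and> continuous_map (subtopology (mtop M) W) (mtop N) f \<and>
    (\<forall>(U, \<phi>)\<in>atlas M. \<forall>(V, \<psi>)\<in>atlas N.
      holomorphic_coord (coords M) (coords N) (\<phi> ` (W \<inter> U \<inter> f -` V)) (\<psi> \<circ> f \<circ> inv_into U \<phi>))"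

definition holomorphic_map ::
    "('a, 'i) manifold \<Rightarrow> ('b, 'j) manifold \<Rightarrow> ('a \<Rightarrow> 'b) \<Rightarrow> bool" where
  "holomorphic_map M N f \<longleftrightarrow> holomorphic_map_on (topspace (mtop M)) M N f"

definition prod_manifold ::
    "('a, 'i) manifold \<Rightarrow> ('b, 'j) manifold \<Rightarrow> ('a \<times> 'b, 'i + 'j) manifold" where
  "prod_manifold M N =
    \<lparr>mtop = prod_topology (mtop M) (mtop N),
     coords = coords M <+> coords N,
     atlas = {(U \<times> V, \<lambda>(x, y). case_sum (\<phi> x) (\<psi> y)) | U \<phi> V \<psi>.
                (U, \<phi>) \<in> atlas M \<and> (V, \<psi>) \<in> atlas N}\<rparr>"

text \<open>The points of the \<open>n\<close>-th power are the \<open>n\<close>-tuples, that is, the extensional functions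
  on \<open>{..<n}\<close>.\<close>

definition power_manifold :: "('a, 'i) manifold \<Rightarrow> nat \<Rightarrow> (nat \<Rightarrow> 'a, nat \<times> 'i) manifold" where
  "power_manifold M n =
    \<lparr>mtop = product_topology (\<lambda>_. mtop M) {..<n},
     coords = {..<n} \<times> coords M,
     atlas = {(Pi\<^sub>E {..<n} (\<lambda>k. fst (c k)),
               \<lambda>x. \<lambda>(k, i)\<in>{..<n} \<times> coords M. snd (c k) (x k) i) | c.
                \<forall>k<n. c k \<in> atlas M}\<rparr>"

definition borel_algebra :: "'a topology \<Rightarrow> 'a measure" where
  "borel_algebra T = sigma (topspace T) {U. openin T U}"


section \<open>Complex Lie groups and holomorphic modules\<close>

record ('a, 'i) lie_group = "'a monoid" +
  mfd :: "('a, 'i) manifold"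

definition complex_lie_group :: "('a, 'i) lie_group \<Rightarrow> bool" where
  "complex_lie_group G \<longleftrightarrow>
    group G \<and> complex_manifold (mfd G) \<and> topspace (mtop (mfd G)) = carrier G \<and>
    holomorphic_map (prod_manifold (mfd G) (mfd G)) (mfd G) (\<lambda>(x, y). x \<otimes>\<^bsub>G\<^esub> y) \<and>
    holomorphic_map (mfd G) (mfd G) (\<lambda>x. inv\<^bsub>G\<^esub> x)"

text \<open>Abelian groups are written multiplicatively, as everywhere in HOL-Algebra: the
  operation of the module \<open>A\<close> is \<open>\<otimes>\<^bsub>A\<^esub>\<close>, and \<open>\<rho> s a\<close> is \<open>s\<close> acting on \<open>a\<close>.\<close>

definition holomorphic_module ::
    "('g, 'i) lie_group \<Rightarrow> ('a, 'j) lie_group \<Rightarrow> ('g \<Rightarrow> 'a \<Rightarrow> 'a) \<Rightarrow> bool" where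
  "holomorphic_module G A \<rho> \<longleftrightarrow>
    complex_lie_group A \<and> comm_group A \<and> \<rho> \<in> hom G (AutoGroup A) \<and>
    holomorphic_map (prod_manifold (mfd G) (mfd A)) (mfd A) (\<lambda>(s, a). \<rho> s a)"


section \<open>Locally holomorphic measurable cohomology\<close>

definition tuples :: "('g, 'i) lie_group \<Rightarrow> nat \<Rightarrow> (nat \<Rightarrow> 'g) set" where
  "tuples G n = Pi\<^sub>E {..<n} (\<lambda>_. carrier G)"

definition locally_holomorphic_at_one ::
    "('g, 'i) lie_group \<Rightarrow> ('a, 'j) lie_group \<Rightarrow> nat \<Rightarrow> ((nat \<Rightarrow> 'g) \<Rightarrow> 'a) \<Rightarrow> bool" where
  "locally_holomorphic_at_one G A n f \<longleftrightarrow>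
    (\<exists>W. (\<lambda>_\<in>{..<n}. \<one>\<^bsub>G\<^esub>) \<in> W \<and> holomorphic_map_on W (power_manifold (mfd G) n) (mfd A) f)"

text \<open>For \<open>n = 0\<close> these are all functions from the one-point set \<open>tuples G 0\<close> to \<open>A\<close>, that is,
  the elements of \<open>A\<close>.\<close>

definition cochains ::
    "('g, 'i) lie_group \<Rightarrow> ('a, 'j) lie_group \<Rightarrow> nat \<Rightarrow> ((nat \<Rightarrow> 'g) \<Rightarrow> 'a) monoid" where
  "cochains G A n =
    \<lparr>carrier = {f \<in> tuples G n \<rightarrow>\<^sub>E carrier A. n \<ge> 1 \<longrightarrow>
        f \<in> borel_algebra (mtop (power_manifold (mfd G) n)) \<rightarrow>\<^sub>M borel_algebra (mtop (mfd A)) \<and>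
        locally_holomorphic_at_one G A n f},
     mult = (\<lambda>f g. \<lambda>s\<in>tuples G n. f s \<otimes>\<^bsub>A\<^esub> g s),
     one = (\<lambda>s\<in>tuples G n. \<one>\<^bsub>A\<^esub>)\<rparr>"

text \<open>Tuples are indexed from 0 here, so the \<open>i\<close>-th entry in the usual counting is \<open>s (i - 1)\<close>.\<close>

definition merge_at :: "('g, 'i) lie_group \<Rightarrow> nat \<Rightarrow> nat \<Rightarrow> (nat \<Rightarrow> 'g) \<Rightarrow> nat \<Rightarrow> 'g" where
  "merge_at G n i s = (\<lambda>j\<in>{..<n}.
     if j < i - 1 then s j
     else if j = i - 1 then s (i - 1) \<otimes>\<^bsub>G\<^esub> s i
     else s (Suc j))"

definition coboundary ::
    "('g, 'i) lie_group \<Rightarrow> ('a, 'j) lie_group \<Rightarrow> ('g \<Rightarrow> 'a \<Rightarrow> 'a) \<Rightarrow> nat \<Rightarrow>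
      ((nat \<Rightarrow> 'g) \<Rightarrow> 'a) \<Rightarrow> (nat \<Rightarrow> 'g) \<Rightarrow> 'a" where
  "coboundary G A \<rho> n f = (\<lambda>s\<in>tuples G (n + 1).
     \<rho> (s 0) (f (\<lambda>j\<in>{..<n}. s (Suc j)))
     \<otimes>\<^bsub>A\<^esub> (\<Otimes>\<^bsub>A\<^esub>i\<in>{1..n}. f (merge_at G n i s) [^]\<^bsub>A\<^esub> ((-1) ^ i :: int))
     \<otimes>\<^bsub>A\<^esub> f (restrict s {..<n}) [^]\<^bsub>A\<^esub> ((-1) ^ (n + 1) :: int))"

definition cocycles ::
    "('g, 'i) lie_group \<Rightarrow> ('a, 'j) lie_group \<Rightarrow> ('g \<Rightarrow> 'a \<Rightarrow> 'a) \<Rightarrow> nat \<Rightarrow>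
      ((nat \<Rightarrow> 'g) \<Rightarrow> 'a) monoid" where
  "cocycles G A \<rho> n =
    (cochains G A n)
      \<lparr>carrier := kernel (cochains G A n) (cochains G A (n + 1)) (coboundary G A \<rho> n)\<rparr>"

definition coboundaries ::
    "('g, 'i) lie_group \<Rightarrow> ('a, 'j) lie_group \<Rightarrow> ('g \<Rightarrow> 'a \<Rightarrow> 'a) \<Rightarrow> nat \<Rightarrow>
      ((nat \<Rightarrow> 'g) \<Rightarrow> 'a) set" where
  "coboundaries G A \<rho> n =
    (if n = 0 then {\<one>\<^bsub>cochains G A 0\<^esub>}
     else coboundary G A \<rho> (n - 1) ` carrier (cochains G A (n - 1)))"

definition H_lhm ::
    "('g, 'i) lie_group \<Rightarrow> ('a, 'j) lie_group \<Rightarrow> ('g \<Rightarrow> 'a \<Rightarrow> 'a) \<Rightarrow> nat \<Rightarrow>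
      ((nat \<Rightarrow> 'g) \<Rightarrow> 'a) set monoid" where
  "H_lhm G A \<rho> n = cocycles G A \<rho> n Mod coboundaries G A \<rho> n"


section \<open>Crossed homomorphisms\<close>

definition holomorphic_crossed_homs ::
    "('g, 'i) lie_group \<Rightarrow> ('a, 'j) lie_group \<Rightarrow> ('g \<Rightarrow> 'a \<Rightarrow> 'a) \<Rightarrow> ('g \<Rightarrow> 'a) monoid" where
  "holomorphic_crossed_homs G A \<rho> =
    \<lparr>carrier = {c \<in> carrier G \<rightarrow>\<^sub>E carrier A.
        holomorphic_map (mfd G) (mfd A) c \<and>
        (\<forall>s\<in>carrier G. \<forall>t\<in>carrier G. c (s \<otimes>\<^bsub>G\<^esub> t) = c s \<otimes>\<^bsub>A\<^esub> \<rho> s (c t))},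
     mult = (\<lambda>c c'. \<lambda>s\<in>carrier G. c s \<otimes>\<^bsub>A\<^esub> c' s),
     one = (\<lambda>s\<in>carrier G. \<one>\<^bsub>A\<^esub>)\<rparr>"

definition principal_crossed_homs ::
    "('g, 'i) lie_group \<Rightarrow> ('a, 'j) lie_group \<Rightarrow> ('g \<Rightarrow> 'a \<Rightarrow> 'a) \<Rightarrow> ('g \<Rightarrow> 'a) set" where
  "principal_crossed_homs G A \<rho> =
    {\<lambda>s\<in>carrier G. \<rho> s a \<otimes>\<^bsub>A\<^esub> inv\<^bsub>A\<^esub> a | a. a \<in> carrier A}"

text \<open>A function on \<open>G\<close> regarded as a function of 1-tuples.\<close>

definition as_cochain :: "('g, 'i) lie_group \<Rightarrow> ('g \<Rightarrow> 'a) \<Rightarrow> (nat \<Rightarrow> 'g) \<Rightarrow> 'a" where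
  "as_cochain G c = (\<lambda>s\<in>tuples G 1. c (s 0))"

end

theory Submission
  imports Defs
begin

section \<open>Complex differentiability\<close>

text \<open>In degree 1 the cocycle condition s f(t) - f(st) + f(s) = 0 is the crossed homomorphism
  identity, and the coboundary of an element a of A is the principal crossed homomorphism s a - a.
  The analytic content is a comparison of regularity: a 1-cochain is measurable and holomorphic near
  the identity, whereas a holomorphic crossed homomorphism is holomorphic on all of G.

  In one direction, a holomorphic map is continuous, hence Borel measurable
  (\<open>as_cochain_cocycle\<close>). In the other, c(t) = c(s) + s c(s^{-1} t) for t near s;
  translation, action and addition are holomorphic, so holomorphy at the identity spreads to every s
  (\<open>crossed_hom_holomorphic\<close>, used by \<open>cocycle_as_cochain\<close>). Hence
  \<open>as_cochain\<close> is an isomorphism onto the 1-cocycles (\<open>as_cochain_iso\<close>).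
  It takes the principal crossed homomorphisms to the coboundaries (\<open>coboundaries_1\<close>),
  so it descends to the quotients (\<open>iso_FactGroup_image\<close>).

  The rest is calculus on manifolds: the chain rule
  \<open>complex_differentiable_at_compose\<close>, its global form
  \<open>holomorphic_map_on_compose\<close>, pairing into products, and the two maps between G and
  its first power (\<open>holomorphic_map_tuple\<close>, \<open>holomorphic_map_component\<close>).
  Compositions pass through products and powers, which therefore need good charts
  (\<open>charted_prod\<close>, \<open>charted_power\<close>).\<close>

lemma topspace_coord_space [simp]: "topspace (coord_space I) = extensional I"
  by (auto simp: coord_space_def PiE_def)

text \<open>The difference quotient at \<open>p\<close> only sees values near \<open>p\<close>. This
  allows coordinate expressions to be rewritten on the open set where
  \<open>inv_into U \<phi>\<close> is known to invert the chart.\<close>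

lemma complex_differentiable_at_cong:
  assumes "openin (coord_space I) S" "p \<in> S" "\<And>v. v \<in> S \<Longrightarrow> g v = h v"
    and "complex_differentiable_at I g p"
  shows "complex_differentiable_at I h p"
proof -
  obtain a where a: "((\<lambda>v. cmod (g v - g p - (\<Sum>i\<in>I. a i * (v i - p i))) / L2_set (\<lambda>i. cmod (v i - p i)) I)
          \<longlongrightarrow> 0) (atin (coord_space I) p)"
    using assms(4) by (auto simp: complex_differentiable_at_def)
  have "\<forall>\<^sub>F v in atin (coord_space I) p. g v = h v"
    using assms(1-3) by (auto simp: eventually_atin)
  then have "\<forall>\<^sub>F v in atin (coord_space I) p.
      cmod (g v - g p - (\<Sum>i\<in>I. a i * (v i - p i))) / L2_set (\<lambda>i. cmod (v i - p i)) I =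
      cmod (h v - h p - (\<Sum>i\<in>I. a i * (v i - p i))) / L2_set (\<lambda>i. cmod (v i - p i)) I"
    by eventually_elim (use assms in simp)
  from tendsto_cong[OF this] a show ?thesis
    unfolding complex_differentiable_at_def by blast
qed

lemma complex_differentiable_at_const: "complex_differentiable_at I (\<lambda>v. c) p"
  unfolding complex_differentiable_at_def by (rule exI[of _ "\<lambda>_. 0"]) simp

lemma complex_differentiable_at_coord:
  assumes "finite I" "i \<in> I"
  shows "complex_differentiable_at I (\<lambda>v. v i) p"
  unfolding complex_differentiable_at_def
proof (rule exI[of _ "\<lambda>j. if j = i then 1 else 0"])
  have "(\<Sum>j\<in>I. (if j = i then 1 else 0) * (v j - p j)) = v i - p i" for v :: "'a \<Rightarrow> complex"
    using assms by (simp add: if_distrib[of "\<lambda>x. x * _"] cong: if_cong)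
  then show "((\<lambda>v. cmod (v i - p i - (\<Sum>j\<in>I. (if j = i then 1 else 0) * (v j - p j)))
      / L2_set (\<lambda>i. cmod (v i - p i)) I) \<longlongrightarrow> 0) (atin (coord_space I) p)"
    by simp
qed

text \<open>Chain rule. The error of the composite is the error of \<open>g\<close>, small compared
  with the distance of \<open>F v\<close> from \<open>q\<close> and hence with \<open>N v\<close>,
  plus the row \<open>b\<close> applied to the errors of the components of \<open>F\<close>.
  Continuity into \<open>coord_space J\<close> also says that \<open>F v\<close> is extensional on
  \<open>S\<close>.\<close>

lemma complex_differentiable_at_compose:
  assumes fin: "finite I" "finite J"
    and S: "openin (coord_space I) S" "p \<in> S"
    and cont: "continuous_map (subtopology (coord_space I) S) (coord_space J) F"
    and F: "\<And>j. j \<in> J \<Longrightarrow> complex_differentiable_at I (\<lambda>v. F v j) p"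
    and g: "complex_differentiable_at J g (F p)"
  shows "complex_differentiable_at I (\<lambda>v. g (F v)) p"
proof -
  define D where "D = atin (coord_space I) p"
  define N where "N v = L2_set (\<lambda>i. cmod (v i - p i)) I" for v
  define q where "q = F p"
  define M where "M w = L2_set (\<lambda>j. cmod (w j - q j)) J" for w
  have "\<exists>a. \<forall>j\<in>J. ((\<lambda>v. cmod (F v j - q j - (\<Sum>i\<in>I. a j i * (v i - p i))) / N v) \<longlongrightarrow> 0) D"
    using F unfolding complex_differentiable_at_def N_def D_def q_def by (intro bchoice) blast
  then obtain a where a: "\<And>j. j \<in> J \<Longrightarrow>
      ((\<lambda>v. cmod (F v j - q j - (\<Sum>i\<in>I. a j i * (v i - p i))) / N v) \<longlongrightarrow> 0) D"
    by blast
  obtain b where b: "((\<lambda>w. cmod (g w - g q - (\<Sum>j\<in>J. b j * (w j - q j))) / M w) \<longlongrightarrow> 0)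
      (atin (coord_space J) q)"
    using g unfolding complex_differentiable_at_def M_def q_def by blast
  define R where "R w = cmod (g w - g q - (\<Sum>j\<in>J. b j * (w j - q j))) / M w" for w
  have [simp]: "N v \<ge> 0" "M w \<ge> 0" "R w \<ge> 0" for v w
    by (auto simp: N_def M_def R_def L2_set_nonneg)
  have S': "S \<subseteq> extensional I" using openin_subset[OF S(1)] by simp
  \<comment> \<open>Distinct extensional vectors differ at an index in \<open>I\<close>, so on
    \<open>S\<close> the denominator vanishes only at \<open>p\<close>.\<close>
  have Npos: "\<forall>\<^sub>F v in D. N v > 0"
    unfolding D_def eventually_atin
  proof (intro disjI2 exI[of _ S] conjI S ballI)
    fix v assume v: "v \<in> S - {p}"
    then have "v \<in> extensional I" "p \<in> extensional I" "v \<noteq> p"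
      using S' S(2) by auto
    then obtain i where "i \<in> I" "v i \<noteq> p i"
      using extensionalityI by blast
    then have "N v \<noteq> 0" using fin by (auto simp: N_def L2_set_eq_0_iff)
    then show "N v > 0" using \<open>N v \<ge> 0\<close> by linarith
  qed
  \<comment> \<open>Without this the limit at \<open>q\<close> would carry no information:
    \<open>atin\<close> is trivial at points outside the space.\<close>
  have q: "q \<in> extensional J"
    using continuous_map_image_subset_topspace[OF cont] S S' by (auto simp: q_def)
  have inS: "\<forall>\<^sub>F v in D. v \<in> S"
    unfolding D_def eventually_atin using S by (intro disjI2 exI[of _ S]) simp
  have RF: "((\<lambda>v. R (F v)) \<longlongrightarrow> 0) D"
  proof (rule tendstoI)
    fix e :: real assume e: "e > 0"
    \<comment> \<open>Since \<open>0 / 0 = 0\<close>, the limit of \<open>R\<close> at \<open>q\<close> is also its value, so that points \<open>v\<close> with \<open>F v = q\<close>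
      need no separate treatment.\<close>
    have "R q = 0" by (simp add: R_def)
    from tendstoD[OF b e] obtain T where T: "openin (coord_space J) T" "q \<in> T"
        "\<And>w. w \<in> T - {q} \<Longrightarrow> dist (R w) 0 < e"
      using q unfolding eventually_atin R_def[symmetric] by auto
    have T': "dist (R w) 0 < e" if "w \<in> T" for w
      using that T(3)[of w] \<open>R q = 0\<close> e by (cases "w = q") auto
    have "openin (subtopology (coord_space I) S)
        {v \<in> topspace (subtopology (coord_space I) S). F v \<in> T}"
      by (rule openin_continuous_map_preimage[OF cont T(1)])
    then have "openin (coord_space I) {v \<in> S. F v \<in> T}"
      using S(1) S' by (simp add: openin_open_subtopology Int_absorb1)
    then show "\<forall>\<^sub>F v in D. dist (R (F v)) 0 < e"
      unfolding D_def eventually_atin using T(2) T' S(2) by (auto simp: q_def)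
  qed
  \<comment> \<open>A Lipschitz constant for \<open>F\<close> at \<open>p\<close>: with tolerance 1,
    component \<open>j\<close> stays within \<open>N v\<close> of its linear part, which is at most
    \<open>N v\<close> times the sum of the moduli of \<open>a j\<close>.\<close>
  define K where "K = (\<Sum>j\<in>J. 1 + (\<Sum>i\<in>I. cmod (a j i)))"
  have "\<forall>\<^sub>F v in D. cmod (F v j - q j) \<le> (1 + (\<Sum>i\<in>I. cmod (a j i))) * N v" if j: "j \<in> J" for j
    using tendstoD[OF a[OF j] zero_less_one] Npos
  proof eventually_elim
    case (elim v)
    have "cmod (F v j - q j - (\<Sum>i\<in>I. a j i * (v i - p i))) \<le> N v"
      using elim by (simp add: field_simps)
    moreover have "cmod (\<Sum>i\<in>I. a j i * (v i - p i)) \<le> (\<Sum>i\<in>I. cmod (a j i) * N v)"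
    proof (rule sum_norm_le)
      fix i assume "i \<in> I"
      then have "cmod (v i - p i) \<le> N v"
        unfolding N_def using fin by (intro member_le_L2_set) auto
      then show "cmod (a j i * (v i - p i)) \<le> cmod (a j i) * N v"
        by (simp add: norm_mult mult_left_mono)
    qed
    ultimately show ?case
      using norm_triangle_sub[of "F v j - q j" "\<Sum>i\<in>I. a j i * (v i - p i)"]
      by (simp add: sum_distrib_right distrib_right)
  qed
  then have "\<forall>\<^sub>F v in D. \<forall>j\<in>J. cmod (F v j - q j) \<le> (1 + (\<Sum>i\<in>I. cmod (a j i))) * N v"
    by (intro eventually_ball_finite fin) auto
  then have MF: "\<forall>\<^sub>F v in D. M (F v) \<le> K * N v"
  proof eventually_elim
    case (elim v)
    have "M (F v) \<le> (\<Sum>j\<in>J. cmod (F v j - q j))"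
      unfolding M_def by (rule L2_set_le_sum) auto
    also have "\<dots> \<le> (\<Sum>j\<in>J. (1 + (\<Sum>i\<in>I. cmod (a j i))) * N v)"
      using elim by (intro sum_mono) auto
    finally show ?case by (simp add: K_def sum_distrib_right)
  qed
  \<comment> \<open>Bounds the difference quotient of the composite; the two summands are the
    contributions of \<open>g\<close> and of \<open>F\<close>.\<close>
  define B where "B v = K * R (F v) + (\<Sum>j\<in>J. cmod (b j) *
      (cmod (F v j - q j - (\<Sum>i\<in>I. a j i * (v i - p i))) / N v))" for v
  have "(B \<longlongrightarrow> K * 0 + (\<Sum>j\<in>J. cmod (b j) * 0)) D"
    unfolding B_def by (intro tendsto_add tendsto_mult tendsto_const tendsto_sum RF a)
  then have B0: "(B \<longlongrightarrow> 0) D" by simp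
  \<comment> \<open>The product of the two Jacobian matrices.\<close>
  define c where "c i = (\<Sum>j\<in>J. b j * a j i)" for i
  have le: "\<forall>\<^sub>F v in D. norm (cmod (g (F v) - g (F p) - (\<Sum>i\<in>I. c i * (v i - p i))) / N v) \<le> B v"
    using MF Npos inS
  proof eventually_elim
    case (elim v)
    define E where "E j = F v j - q j - (\<Sum>i\<in>I. a j i * (v i - p i))" for j
    define H where "H = g (F v) - g q - (\<Sum>j\<in>J. b j * (F v j - q j))"
    have "(\<Sum>i\<in>I. c i * (v i - p i)) = (\<Sum>j\<in>J. b j * (\<Sum>i\<in>I. a j i * (v i - p i)))"
      unfolding c_def sum_distrib_right sum_distrib_left
      by (subst sum.swap) (simp add: mult.assoc)
    then have eq: "g (F v) - g (F p) - (\<Sum>i\<in>I. c i * (v i - p i)) = H + (\<Sum>j\<in>J. b j * E j)"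
      by (simp add: H_def E_def q_def right_diff_distrib sum_subtractf)
    have "cmod H \<le> R (F v) * M (F v)"
    proof (cases "M (F v) = 0")
      \<comment> \<open>Here \<open>R (F v)\<close> is a quotient by zero, so \<open>H\<close>
        itself must vanish; it does, because \<open>F v\<close> and \<open>q\<close> are extensional
        and agree on \<open>J\<close>.\<close>
      case True
      have "F v j = q j" if "j \<in> J" for j
        using True that fin by (auto simp: M_def L2_set_eq_0_iff)
      moreover have "F v \<in> extensional J"
        using continuous_map_image_subset_topspace[OF cont] S' elim by auto
      ultimately have "F v = q" using q extensionalityI by blast
      then show ?thesis by (simp add: H_def)
    qed (simp add: H_def R_def)
    also have "\<dots> \<le> R (F v) * (K * N v)"
      using elim by (intro mult_left_mono) auto
    finally have "cmod H \<le> K * R (F v) * N v" by (simp add: mult_ac)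
    moreover have "cmod (\<Sum>j\<in>J. b j * E j) \<le> (\<Sum>j\<in>J. cmod (b j) * cmod (E j))"
      by (rule sum_norm_le) (simp add: norm_mult)
    ultimately have "cmod (H + (\<Sum>j\<in>J. b j * E j)) \<le>
        K * R (F v) * N v + (\<Sum>j\<in>J. cmod (b j) * cmod (E j))"
      by (meson add_mono norm_triangle_le)
    also have "\<dots> = B v * N v"
      using elim by (simp add: B_def E_def distrib_right sum_distrib_right)
    finally show ?case using elim by (simp add: eq pos_divide_le_eq)
  qed
  show ?thesis
    unfolding complex_differentiable_at_def
    using Lim_null_comparison[OF le B0] unfolding D_def N_def by blast
qed

section \<open>Holomorphic maps between manifolds\<close>

text \<open>The part of \<open>complex_manifold\<close> that matters for composing holomorphic maps; transition maps
  play no role in it.\<close>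

definition charted :: "('a, 'i) manifold \<Rightarrow> bool" where
  "charted M \<longleftrightarrow> finite (coords M) \<and> (\<Union>(U, \<phi>)\<in>atlas M. U) = topspace (mtop M) \<and>
    (\<forall>(U, \<phi>)\<in>atlas M.
      openin (mtop M) U \<and> openin (coord_space (coords M)) (\<phi> ` U) \<and>
      homeomorphic_map (subtopology (mtop M) U)
        (subtopology (coord_space (coords M)) (\<phi> ` U)) \<phi>)"

lemma complex_manifold_charted: "complex_manifold M \<Longrightarrow> charted M"
  by (simp add: complex_manifold_def charted_def)

lemma charted_finite: "charted M \<Longrightarrow> finite (coords M)"
  by (simp add: charted_def)

lemma charted_cover:
  assumes "charted M" "x \<in> topspace (mtop M)"
  obtains U \<phi> where "(U, \<phi>) \<in> atlas M" "x \<in> U"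
  using assms unfolding charted_def by blast

section \<open>Charts as homeomorphisms onto open sets\<close>

context
  fixes M :: "('a, 'i) manifold" and U \<phi>
  assumes M: "charted M" and chart: "(U, \<phi>) \<in> atlas M"
begin

lemma chart_open: "openin (mtop M) U"
  using M chart by (auto simp: charted_def)

lemma chart_open_image: "openin (coord_space (coords M)) (\<phi> ` U)"
  using M chart by (auto simp: charted_def)

lemma chart_homeomorphic: "homeomorphic_map (subtopology (mtop M) U)
    (subtopology (coord_space (coords M)) (\<phi> ` U)) \<phi>"
  using M chart by (auto simp: charted_def)

lemma chart_topspace: "topspace (subtopology (mtop M) U) = U"
  using openin_subset[OF chart_open] by auto

lemma chart_extensional: "x \<in> U \<Longrightarrow> \<phi> x \<in> extensional (coords M)"
  using openin_subset[OF chart_open_image] by auto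

lemma chart_inj: "inj_on \<phi> U"
  using homeomorphic_imp_injective_map[OF chart_homeomorphic] chart_topspace by simp

lemma chart_inv [simp]: "x \<in> U \<Longrightarrow> inv_into U \<phi> (\<phi> x) = x"
  by (rule inv_into_f_f[OF chart_inj])

lemma chart_continuous: "continuous_map (subtopology (mtop M) U) (coord_space (coords M)) \<phi>"
  using homeomorphic_imp_continuous_map[OF chart_homeomorphic]
  by (simp add: continuous_map_in_subtopology)

lemma chart_image_open:
  assumes "openin (mtop M) W" "W \<subseteq> U"
  shows "openin (coord_space (coords M)) (\<phi> ` W)"
proof -
  have "openin (subtopology (mtop M) U) W"
    using assms chart_open by (simp add: openin_open_subtopology)
  then have "openin (subtopology (coord_space (coords M)) (\<phi> ` U)) (\<phi> ` W)"
    using homeomorphic_imp_open_map[OF chart_homeomorphic] by (simp add: open_map_def)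
  then show ?thesis using chart_open_image by (simp add: openin_open_subtopology)
qed

text \<open>The inverse supplied by the homeomorphism is only an existential witness; injectivity of
  the chart identifies it with \<open>inv_into U \<phi>\<close>, the form in which holomorphy is
  defined.\<close>

lemma chart_inv_continuous:
  "continuous_map (subtopology (coord_space (coords M)) (\<phi> ` U)) (mtop M) (inv_into U \<phi>)"
proof -
  obtain g where g: "homeomorphic_maps (subtopology (mtop M) U)
      (subtopology (coord_space (coords M)) (\<phi> ` U)) \<phi> g"
    using chart_homeomorphic homeomorphic_map_maps by blast
  have "continuous_map (subtopology (coord_space (coords M)) (\<phi> ` U)) (mtop M) g"
    using g by (simp add: homeomorphic_maps_def continuous_map_in_subtopology)
  moreover have "g v = inv_into U \<phi> v"
    if "v \<in> topspace (subtopology (coord_space (coords M)) (\<phi> ` U))" for v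
    using that g chart_topspace by (auto simp: homeomorphic_maps_def)
  ultimately show ?thesis by (rule continuous_map_eq)
qed

end

section \<open>Composition, congruence and gluing of holomorphic maps\<close>

lemma holomorphic_map_on_open: "holomorphic_map_on W M N f \<Longrightarrow> openin (mtop M) W"
  by (simp add: holomorphic_map_on_def)

lemma holomorphic_map_on_continuous:
  "holomorphic_map_on W M N f \<Longrightarrow> continuous_map (subtopology (mtop M) W) (mtop N) f"
  by (simp add: holomorphic_map_on_def)

lemma holomorphic_map_on_preimage:
  assumes "holomorphic_map_on W M N f" "openin (mtop N) V"
  shows "openin (mtop M) (W \<inter> f -` V)"
proof -
  have W: "openin (mtop M) W" by (rule holomorphic_map_on_open[OF assms(1)])
  have "openin (subtopology (mtop M) W) {x \<in> topspace (subtopology (mtop M) W). f x \<in> V}"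
    by (rule openin_continuous_map_preimage[OF holomorphic_map_on_continuous[OF assms(1)] assms(2)])
  moreover have "{x \<in> topspace (subtopology (mtop M) W). f x \<in> V} = W \<inter> f -` V"
    using openin_subset[OF W] by auto
  ultimately show ?thesis using W by (simp add: openin_open_subtopology)
qed

lemma holomorphic_map_onD:
  assumes "holomorphic_map_on W M N f" "(U, \<phi>) \<in> atlas M" "(V, \<psi>) \<in> atlas N"
    "x \<in> W" "x \<in> U" "f x \<in> V" "j \<in> coords N"
  shows "complex_differentiable_at (coords M) (\<lambda>v. \<psi> (f (inv_into U \<phi> v)) j) (\<phi> x)"
  using assms unfolding holomorphic_map_on_def holomorphic_coord_def by fastforce

lemma holomorphic_map_onI:
  assumes "openin (mtop M) W" "continuous_map (subtopology (mtop M) W) (mtop N) f"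
    and "\<And>U \<phi> V \<psi> x j. \<lbrakk>(U, \<phi>) \<in> atlas M; (V, \<psi>) \<in> atlas N; x \<in> W; x \<in> U; f x \<in> V; j \<in> coords N\<rbrakk> \<Longrightarrow>
      complex_differentiable_at (coords M) (\<lambda>v. \<psi> (f (inv_into U \<phi> v)) j) (\<phi> x)"
  shows "holomorphic_map_on W M N f"
  using assms unfolding holomorphic_map_on_def holomorphic_coord_def by auto

lemma holomorphic_map_continuous: "holomorphic_map M N f \<Longrightarrow> continuous_map (mtop M) (mtop N) f"
  using holomorphic_map_on_continuous[of "topspace (mtop M)" M N f] by (simp add: holomorphic_map_def)

lemma holomorphic_map_in: "holomorphic_map M N f \<Longrightarrow> x \<in> topspace (mtop M) \<Longrightarrow> f x \<in> topspace (mtop N)"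
  using holomorphic_map_continuous continuous_map_image_subset_topspace by fast

text \<open>A chart \<open>\<psi>\<close> of \<open>N\<close> around \<open>f x\<close> is inserted,
  and the chain rule is applied to the coordinate expressions of \<open>f\<close> and
  \<open>g\<close>. Holomorphy refers to every pair of charts, so the same \<open>\<psi>\<close>
  serves both maps.\<close>

lemma holomorphic_map_on_compose:
  assumes M: "charted M" and N: "charted N"
    and f: "holomorphic_map_on W M N f" and g: "holomorphic_map_on W' N P g"
  shows "holomorphic_map_on (W \<inter> f -` W') M P (\<lambda>x. g (f x))"
proof (rule holomorphic_map_onI)
  show "openin (mtop M) (W \<inter> f -` W')"
    by (rule holomorphic_map_on_preimage[OF f holomorphic_map_on_open[OF g]])
  have "continuous_map (subtopology (mtop M) (W \<inter> f -` W')) (subtopology (mtop N) W') f"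
    using continuous_map_from_subtopology[OF holomorphic_map_on_continuous[OF f], of "f -` W'"]
    by (auto simp: continuous_map_in_subtopology subtopology_subtopology)
  from continuous_map_compose[OF this holomorphic_map_on_continuous[OF g]]
  show "continuous_map (subtopology (mtop M) (W \<inter> f -` W')) (mtop P) (\<lambda>x. g (f x))"
    by (simp add: o_def)
next
  fix U \<phi> Q \<xi> x j
  assume U: "(U, \<phi>) \<in> atlas M" and Q: "(Q, \<xi>) \<in> atlas P"
    and x: "x \<in> W \<inter> f -` W'" "x \<in> U" "g (f x) \<in> Q" "j \<in> coords P"
  have "f x \<in> topspace (mtop N)"
    using x openin_subset[OF holomorphic_map_on_open[OF g]] by auto
  then obtain V \<psi> where V: "(V, \<psi>) \<in> atlas N" "f x \<in> V" using charted_cover[OF N] by blast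
  note [simp] = chart_inv[OF M U] chart_inv[OF N V(1)]
  \<comment> \<open>The part of the chart image on which \<open>f\<close> stays in \<open>V\<close>,
    so that \<open>inv_into V \<psi>\<close> undoes \<open>\<psi>\<close> there.\<close>
  define S where "S = \<phi> ` (U \<inter> (W \<inter> f -` V))"
  define F where "F v = \<psi> (f (inv_into U \<phi> v))" for v
  have S: "openin (coord_space (coords M)) S"
    unfolding S_def
    by (intro chart_image_open[OF M U] openin_Int chart_open[OF M U] holomorphic_map_on_preimage[OF f]
        chart_open[OF N V(1)]) auto
  have "continuous_map (subtopology (coord_space (coords M)) S) (mtop M) (inv_into U \<phi>)"
    by (rule continuous_map_from_subtopology_mono[OF chart_inv_continuous[OF M U]]) (auto simp: S_def)
  then have "continuous_map (subtopology (coord_space (coords M)) S)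
      (subtopology (mtop M) (W \<inter> f -` V)) (inv_into U \<phi>)"
    by (auto simp: continuous_map_in_subtopology S_def)
  moreover have "continuous_map (subtopology (mtop M) (W \<inter> f -` V)) (subtopology (mtop N) V) f"
    using continuous_map_from_subtopology[OF holomorphic_map_on_continuous[OF f], of "f -` V"]
    by (auto simp: continuous_map_in_subtopology subtopology_subtopology)
  ultimately have "continuous_map (subtopology (coord_space (coords M)) S)
      (coord_space (coords N)) (\<psi> \<circ> (f \<circ> inv_into U \<phi>))"
    by (intro continuous_map_compose[OF continuous_map_compose chart_continuous[OF N V(1)]])
  then have cont: "continuous_map (subtopology (coord_space (coords M)) S) (coord_space (coords N)) F"
    by (simp add: F_def[abs_def] o_def)
  have "complex_differentiable_at (coords M) (\<lambda>v. \<xi> (g (inv_into V \<psi> (F v))) j) (\<phi> x)"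
  proof (rule complex_differentiable_at_compose[OF charted_finite[OF M] charted_finite[OF N] S _ cont])
    show "\<phi> x \<in> S" using x V by (auto simp: S_def)
    show "complex_differentiable_at (coords M) (\<lambda>v. F v i) (\<phi> x)" if "i \<in> coords N" for i
      unfolding F_def using holomorphic_map_onD[OF f U V(1)] x V(2) that by auto
    have "F (\<phi> x) = \<psi> (f x)" using x by (simp add: F_def)
    then show "complex_differentiable_at (coords N) (\<lambda>w. \<xi> (g (inv_into V \<psi> w)) j) (F (\<phi> x))"
      using holomorphic_map_onD[OF g V(1) Q, of "f x" j] x V(2) by simp
  qed
  then show "complex_differentiable_at (coords M) (\<lambda>v. \<xi> (g (f (inv_into U \<phi> v))) j) (\<phi> x)"
    by (rule complex_differentiable_at_cong[OF S, rotated 2]) (use x V in \<open>auto simp: S_def F_def\<close>)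
qed

lemma holomorphic_map_compose:
  assumes "charted M" "charted N" "holomorphic_map M N f" "holomorphic_map N P g"
  shows "holomorphic_map M P (\<lambda>x. g (f x))"
proof -
  have "topspace (mtop M) \<inter> f -` topspace (mtop N) = topspace (mtop M)"
    using holomorphic_map_in[OF assms(3)] by auto
  then show ?thesis
    using holomorphic_map_on_compose[OF assms(1,2)] assms(3,4) unfolding holomorphic_map_def by metis
qed

lemma holomorphic_map_on_cong:
  assumes M: "charted M" and N: "charted N"
    and f: "holomorphic_map_on W M N f" and eq: "\<And>x. x \<in> W \<Longrightarrow> f x = g x"
  shows "holomorphic_map_on W M N g"
proof (rule holomorphic_map_onI)
  show "openin (mtop M) W" by (rule holomorphic_map_on_open[OF f])
  show "continuous_map (subtopology (mtop M) W) (mtop N) g"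
    by (rule continuous_map_eq[OF holomorphic_map_on_continuous[OF f]]) (auto simp: eq)
next
  fix U \<phi> V \<psi> x j
  assume U: "(U, \<phi>) \<in> atlas M" and V: "(V, \<psi>) \<in> atlas N"
    and x: "x \<in> W" "x \<in> U" "g x \<in> V" "j \<in> coords N"
  note [simp] = chart_inv[OF M U]
  have S: "openin (coord_space (coords M)) (\<phi> ` (U \<inter> W))"
    by (intro chart_image_open[OF M U] openin_Int chart_open[OF M U] holomorphic_map_on_open[OF f]) auto
  have "complex_differentiable_at (coords M) (\<lambda>v. \<psi> (f (inv_into U \<phi> v)) j) (\<phi> x)"
    using holomorphic_map_onD[OF f U V] x eq by simp
  then show "complex_differentiable_at (coords M) (\<lambda>v. \<psi> (g (inv_into U \<phi> v)) j) (\<phi> x)"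
    by (rule complex_differentiable_at_cong[OF S, rotated 2]) (use x in \<open>auto simp: eq\<close>)
qed

lemma holomorphic_map_cong:
  assumes "charted M" "charted N" "holomorphic_map M N f" "\<And>x. x \<in> topspace (mtop M) \<Longrightarrow> f x = g x"
  shows "holomorphic_map M N g"
  using holomorphic_map_on_cong assms unfolding holomorphic_map_def by metis

text \<open>Continuity is glued by the pasting lemma, and differentiability is pointwise. This
  reduces holomorphy of a crossed homomorphism to a neighbourhood of each point.\<close>

lemma holomorphic_map_local:
  assumes "\<And>x. x \<in> topspace (mtop M) \<Longrightarrow> \<exists>W. x \<in> W \<and> holomorphic_map_on W M N f"
  shows "holomorphic_map M N f"
  unfolding holomorphic_map_def
proof (rule holomorphic_map_onI)
  obtain W where W: "\<And>x. x \<in> topspace (mtop M) \<Longrightarrow> x \<in> W x \<and> holomorphic_map_on (W x) M N f"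
    using assms by metis
  show "continuous_map (subtopology (mtop M) (topspace (mtop M))) (mtop N) f"
    unfolding subtopology_topspace
  proof (rule pasting_lemma[where I = "topspace (mtop M)" and T = W and f = "\<lambda>_. f"])
    show "openin (mtop M) (W x)" if "x \<in> topspace (mtop M)" for x
      using W[OF that] holomorphic_map_on_open by blast
    show "continuous_map (subtopology (mtop M) (W x)) (mtop N) f" if "x \<in> topspace (mtop M)" for x
      using W[OF that] holomorphic_map_on_continuous by blast
  qed (use W in auto)
next
  fix U \<phi> V \<psi> x j
  assume *: "(U, \<phi>) \<in> atlas M" "(V, \<psi>) \<in> atlas N" "x \<in> topspace (mtop M)" "x \<in> U" "f x \<in> V" "j \<in> coords N"
  obtain W where "x \<in> W" "holomorphic_map_on W M N f" using assms[OF *(3)] by blast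
  then show "complex_differentiable_at (coords M) (\<lambda>v. \<psi> (f (inv_into U \<phi> v)) j) (\<phi> x)"
    using holomorphic_map_onD[of W M N f] * by blast
qed simp

section \<open>Constants, identity, pairs and tuples\<close>

lemma holomorphic_map_const:
  assumes "c \<in> topspace (mtop N)"
  shows "holomorphic_map M N (\<lambda>_. c)"
  unfolding holomorphic_map_def
  by (rule holomorphic_map_onI) (auto simp: assms complex_differentiable_at_const)

text \<open>The coordinate expressions of the identity are the transition maps, so this is where
  compatibility of the charts enters.\<close>

lemma holomorphic_map_id:
  assumes "complex_manifold M"
  shows "holomorphic_map M M (\<lambda>x. x)"
  unfolding holomorphic_map_def
proof (rule holomorphic_map_onI)
  fix U \<phi> V \<psi> x j
  assume *: "(U, \<phi>) \<in> atlas M" "(V, \<psi>) \<in> atlas M" "x \<in> U" "x \<in> V" "j \<in> coords M"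
  have "holomorphic_coord (coords M) (coords M) (\<phi> ` (U \<inter> V)) (\<psi> \<circ> inv_into U \<phi>)"
    using assms *(1,2) unfolding complex_manifold_def by blast
  then show "complex_differentiable_at (coords M) (\<lambda>v. \<psi> (inv_into U \<phi> v) j) (\<phi> x)"
    using * by (auto simp: holomorphic_coord_def)
qed auto

text \<open>Coordinates tagged \<open>Inl\<close> come from \<open>f\<close> and those tagged
  \<open>Inr\<close> from \<open>g\<close>. Multiplication and action are given as holomorphic maps
  on product manifolds, and this feeds two maps with a common source into them.\<close>

lemma holomorphic_map_pair:
  assumes f: "holomorphic_map M N f" and g: "holomorphic_map M P g"
  shows "holomorphic_map M (prod_manifold N P) (\<lambda>x. (f x, g x))"
  unfolding holomorphic_map_def
proof (rule holomorphic_map_onI)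
  show "continuous_map (subtopology (mtop M) (topspace (mtop M))) (mtop (prod_manifold N P)) (\<lambda>x. (f x, g x))"
    using f[THEN holomorphic_map_continuous] g[THEN holomorphic_map_continuous]
    by (simp add: prod_manifold_def continuous_map_pairedI)
next
  fix U \<phi> V \<psi> x j
  assume U: "(U, \<phi>) \<in> atlas M" and V: "(V, \<psi>) \<in> atlas (prod_manifold N P)"
    and x: "x \<in> topspace (mtop M)" "x \<in> U" "(f x, g x) \<in> V" "j \<in> coords (prod_manifold N P)"
  obtain V1 \<psi>1 V2 \<psi>2 where VV: "V = V1 \<times> V2" "\<psi> = (\<lambda>(x, y). case_sum (\<psi>1 x) (\<psi>2 y))"
      "(V1, \<psi>1) \<in> atlas N" "(V2, \<psi>2) \<in> atlas P"
    using V by (auto simp: prod_manifold_def)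
  show "complex_differentiable_at (coords M)
      (\<lambda>v. \<psi> (f (inv_into U \<phi> v), g (inv_into U \<phi> v)) j) (\<phi> x)"
  proof (cases j)
    case (Inl a)
    then show ?thesis
      using holomorphic_map_onD[OF f[unfolded holomorphic_map_def] U VV(3)] x VV
      by (auto simp: prod_manifold_def)
  next
    case (Inr a)
    then show ?thesis
      using holomorphic_map_onD[OF g[unfolded holomorphic_map_def] U VV(4)] x VV
      by (auto simp: prod_manifold_def)
  qed
qed simp

lemma power_manifold_simps [simp]:
  "mtop (power_manifold M n) = product_topology (\<lambda>_. mtop M) {..<n}"
  "coords (power_manifold M n) = {..<n} \<times> coords M"
  by (simp_all add: power_manifold_def)

text \<open>Coordinate \<open>(k, i)\<close> depends on entry \<open>k\<close> only. The case
  \<open>n = 1\<close> with the identity is the passage from group elements to 1-tuples.\<close>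

lemma holomorphic_map_tuple:
  assumes f: "\<And>k. k < n \<Longrightarrow> holomorphic_map M N (f k)"
  shows "holomorphic_map M (power_manifold N n) (\<lambda>x. \<lambda>k\<in>{..<n}. f k x)"
  unfolding holomorphic_map_def
proof (rule holomorphic_map_onI)
  show "continuous_map (subtopology (mtop M) (topspace (mtop M))) (mtop (power_manifold N n))
      (\<lambda>x. \<lambda>k\<in>{..<n}. f k x)"
    unfolding subtopology_topspace power_manifold_simps continuous_map_componentwise
  proof (intro conjI ballI)
    fix k assume k: "k \<in> {..<n}"
    show "continuous_map (mtop M) (mtop N) (\<lambda>x. (\<lambda>k\<in>{..<n}. f k x) k)"
      using holomorphic_map_continuous[OF f] k by simp
  qed auto
next
  fix U \<phi> V \<psi> x j
  assume U: "(U, \<phi>) \<in> atlas M" and V: "(V, \<psi>) \<in> atlas (power_manifold N n)"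
    and x: "x \<in> topspace (mtop M)" "x \<in> U" "(\<lambda>k\<in>{..<n}. f k x) \<in> V"
      "j \<in> coords (power_manifold N n)"
  obtain c where c: "V = Pi\<^sub>E {..<n} (\<lambda>k. fst (c k))"
      "\<psi> = (\<lambda>x. \<lambda>(k, i)\<in>{..<n} \<times> coords N. snd (c k) (x k) i)" "\<And>k. k < n \<Longrightarrow> c k \<in> atlas N"
    using V by (auto simp: power_manifold_def)
  obtain k i where j: "j = (k, i)" "k < n" "i \<in> coords N" using x by auto
  have "f k x \<in> fst (c k)" using x(3) j(2) unfolding c(1) by (auto dest: PiE_mem)
  then show "complex_differentiable_at (coords M)
      (\<lambda>v. \<psi> (\<lambda>k\<in>{..<n}. f k (inv_into U \<phi> v)) j) (\<phi> x)"
    using holomorphic_map_onD[OF f[OF j(2), unfolded holomorphic_map_def] U, of "fst (c k)" "snd (c k)" x i]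
      c j x by simp
qed simp

section \<open>Charts of product manifolds\<close>

lemma homeomorphic_map_chartI:
  assumes "openin X U" "continuous_map (subtopology X U) Y f"
    and "continuous_map (subtopology Y (f ` U)) X g" "\<And>x. x \<in> U \<Longrightarrow> g (f x) = x"
  shows "homeomorphic_map (subtopology X U) (subtopology Y (f ` U)) f"
proof -
  have "U \<subseteq> topspace X" by (rule openin_subset[OF assms(1)])
  then have "homeomorphic_maps (subtopology X U) (subtopology Y (f ` U)) f g"
    using assms(2-4) by (auto simp: homeomorphic_maps_def continuous_map_in_subtopology)
  then show ?thesis using homeomorphic_map_maps by blast
qed

lemma coord_space_continuousI:
  assumes "\<And>x. x \<in> topspace X \<Longrightarrow> f x \<in> extensional I"
    and "\<And>i. i \<in> I \<Longrightarrow> continuous_map X euclidean (\<lambda>x. f x i)"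
  shows "continuous_map X (coord_space I) f"
  using assms by (auto simp: coord_space_def continuous_map_componentwise)

lemma coord_space_continuous_component:
  assumes "continuous_map X (coord_space I) f" "i \<in> I"
  shows "continuous_map X euclidean (\<lambda>x. f x i)"
  using assms by (auto simp: coord_space_def continuous_map_componentwise)

text \<open>Yields the projections from the coordinates of a product or power to those of one
  factor.\<close>

lemma coord_space_continuous_reindex:
  assumes "\<And>i. i \<in> I \<Longrightarrow> h i \<in> J"
  shows "continuous_map (coord_space J) (coord_space I) (\<lambda>v. \<lambda>i\<in>I. v (h i))"
proof (rule coord_space_continuousI)
  fix i assume "i \<in> I"
  then show "continuous_map (coord_space J) euclidean (\<lambda>v. (\<lambda>i\<in>I. v (h i)) i)"
    using coord_space_continuous_component[OF continuous_map_id, of "h i" J] assms by (simp add: id_def)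
qed simp

text \<open>The coordinate blocks \<open>L\<close> and \<open>R\<close> recover the two factor
  charts from \<open>\<Phi>\<close>; inverting the factor charts on these blocks gives a continuous
  inverse of \<open>\<Phi>\<close>.\<close>

lemma charted_prod:
  assumes M: "charted M" and N: "charted N"
  shows "charted (prod_manifold M N)"
  unfolding charted_def
proof (intro conjI ballI)
  show "finite (coords (prod_manifold M N))"
    using M N by (simp add: prod_manifold_def charted_finite)
  show "(\<Union>(U, \<phi>)\<in>atlas (prod_manifold M N). U) = topspace (mtop (prod_manifold M N))"
  proof (intro equalityI subsetI)
    fix z assume "z \<in> (\<Union>(U, \<phi>)\<in>atlas (prod_manifold M N). U)"
    then obtain U \<phi> V \<psi> where "(U, \<phi>) \<in> atlas M" "(V, \<psi>) \<in> atlas N" "z \<in> U \<times> V"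
      by (auto simp: prod_manifold_def)
    then show "z \<in> topspace (mtop (prod_manifold M N))"
      using openin_subset[OF chart_open[OF M]] openin_subset[OF chart_open[OF N]]
      by (fastforce simp: prod_manifold_def)
  next
    fix z assume "z \<in> topspace (mtop (prod_manifold M N))"
    then have "fst z \<in> topspace (mtop M)" "snd z \<in> topspace (mtop N)"
      by (auto simp: prod_manifold_def)
    then obtain U \<phi> V \<psi> where UV: "(U, \<phi>) \<in> atlas M" "fst z \<in> U" "(V, \<psi>) \<in> atlas N" "snd z \<in> V"
      using charted_cover[OF M, of "fst z" thesis] charted_cover[OF N, of "snd z" thesis] by blast
    then have "(U \<times> V, \<lambda>(x, y). case_sum (\<phi> x) (\<psi> y)) \<in> atlas (prod_manifold M N)" "z \<in> U \<times> V"
      by (auto simp: prod_manifold_def mem_Times_iff)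
    then show "z \<in> (\<Union>(U, \<phi>)\<in>atlas (prod_manifold M N). U)" by blast
  qed
  fix z assume "z \<in> atlas (prod_manifold M N)"
  then obtain U \<phi> V \<psi> where z: "z = (U \<times> V, \<lambda>(x, y). case_sum (\<phi> x) (\<psi> y))"
    and U: "(U, \<phi>) \<in> atlas M" and V: "(V, \<psi>) \<in> atlas N"
    by (auto simp: prod_manifold_def)
  define I where "I = coords M"
  define J where "J = coords N"
  define C where "C = coord_space (I <+> J)"
  define \<Phi> where "\<Phi> = (\<lambda>(x, y). case_sum (\<phi> x) (\<psi> y))"
  define L where "L v = (\<lambda>i\<in>I. v (Inl i))" for v :: "'b + 'd \<Rightarrow> complex"
  define R where "R v = (\<lambda>j\<in>J. v (Inr j))" for v :: "'b + 'd \<Rightarrow> complex"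
  have [simp]: "L (\<Phi> (x, y)) = \<phi> x" "R (\<Phi> (x, y)) = \<psi> y" if "x \<in> U" "y \<in> V" for x y
    using that chart_extensional[OF M U] chart_extensional[OF N V]
    by (simp_all add: L_def R_def \<Phi>_def I_def J_def extensional_restrict cong: restrict_cong)
  have ext: "\<Phi> (x, y) \<in> extensional (I <+> J)" if "x \<in> U" "y \<in> V" for x y
    using chart_extensional[OF M U that(1)] chart_extensional[OF N V that(2)]
    by (auto simp: \<Phi>_def I_def J_def extensional_def split: sum.split)
  have L: "continuous_map C (coord_space I) L" and R: "continuous_map C (coord_space J) R"
    unfolding C_def L_def[abs_def] R_def[abs_def] by (auto intro!: coord_space_continuous_reindex)
  have UV: "openin (prod_topology (mtop M) (mtop N)) (U \<times> V)"
    by (simp add: openin_prod_Times_iff chart_open[OF M U] chart_open[OF N V])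
  \<comment> \<open>As an intersection of preimages under \<open>L\<close> and \<open>R\<close> the
    image is visibly open. An extensional \<open>v\<close> is determined by its two blocks.\<close>
  have image: "\<Phi> ` (U \<times> V) = {v \<in> topspace C. L v \<in> \<phi> ` U} \<inter> {v \<in> topspace C. R v \<in> \<psi> ` V}"
  proof (intro equalityI subsetI)
    fix v assume "v \<in> {v \<in> topspace C. L v \<in> \<phi> ` U} \<inter> {v \<in> topspace C. R v \<in> \<psi> ` V}"
    then obtain x y where xy: "x \<in> U" "y \<in> V" "L v = \<phi> x" "R v = \<psi> y" "v \<in> extensional (I <+> J)"
      by (auto simp: C_def)
    have "v = \<Phi> (x, y)"
    proof (rule extensionalityI[OF xy(5) ext[OF xy(1,2)]])
      fix k assume "k \<in> I <+> J"
      then show "v k = \<Phi> (x, y) k"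
      proof (elim PlusE)
        fix i assume "i \<in> I" "k = Inl i"
        then show ?thesis using fun_cong[OF xy(3), of i] by (simp add: \<Phi>_def L_def)
      next
        fix j assume "j \<in> J" "k = Inr j"
        then show ?thesis using fun_cong[OF xy(4), of j] by (simp add: \<Phi>_def R_def)
      qed
    qed
    then show "v \<in> \<Phi> ` (U \<times> V)" using xy by blast
  qed (auto simp: C_def ext)
  have openC: "openin C (\<Phi> ` (U \<times> V))"
    unfolding image using chart_open_image[OF M U] chart_open_image[OF N V]
    by (intro openin_Int openin_continuous_map_preimage[OF L] openin_continuous_map_preimage[OF R])
      (simp_all add: I_def J_def)
  have cont: "continuous_map (subtopology (prod_topology (mtop M) (mtop N)) (U \<times> V)) C \<Phi>"
    unfolding C_def
  proof (rule coord_space_continuousI)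
    have top: "subtopology (prod_topology (mtop M) (mtop N)) (U \<times> V) =
        prod_topology (subtopology (mtop M) U) (subtopology (mtop N) V)"
      by (rule subtopology_Times)
    fix k assume "k \<in> I <+> J"
    then show "continuous_map (subtopology (prod_topology (mtop M) (mtop N)) (U \<times> V)) euclidean (\<lambda>x. \<Phi> x k)"
      unfolding top
    proof (elim PlusE)
      fix i assume k: "i \<in> I" "k = Inl i"
      show "continuous_map (prod_topology (subtopology (mtop M) U) (subtopology (mtop N) V)) euclidean (\<lambda>x. \<Phi> x k)"
        using coord_space_continuous_component[OF
            continuous_map_compose[OF continuous_map_fst chart_continuous[OF M U]]] k
        by (simp add: \<Phi>_def I_def case_prod_beta)
    next
      fix j assume k: "j \<in> J" "k = Inr j"
      show "continuous_map (prod_topology (subtopology (mtop M) U) (subtopology (mtop N) V)) euclidean (\<lambda>x. \<Phi> x k)"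
        using coord_space_continuous_component[OF
            continuous_map_compose[OF continuous_map_snd chart_continuous[OF N V]]] k
        by (simp add: \<Phi>_def J_def case_prod_beta)
    qed
  qed (auto simp: ext)
  have inv: "continuous_map (subtopology C (\<Phi> ` (U \<times> V))) (prod_topology (mtop M) (mtop N))
      (\<lambda>v. (inv_into U \<phi> (L v), inv_into V \<psi> (R v)))"
  proof (rule continuous_map_pairedI)
    have "continuous_map (subtopology C (\<Phi> ` (U \<times> V))) (subtopology (coord_space I) (\<phi> ` U)) L"
      using continuous_map_from_subtopology[OF L] by (auto simp: continuous_map_in_subtopology)
    from continuous_map_compose[OF this chart_inv_continuous[OF M U, folded I_def]]
    show "continuous_map (subtopology C (\<Phi> ` (U \<times> V))) (mtop M) (\<lambda>v. inv_into U \<phi> (L v))"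
      by (simp add: o_def)
    have "continuous_map (subtopology C (\<Phi> ` (U \<times> V))) (subtopology (coord_space J) (\<psi> ` V)) R"
      using continuous_map_from_subtopology[OF R] by (auto simp: continuous_map_in_subtopology)
    from continuous_map_compose[OF this chart_inv_continuous[OF N V, folded J_def]]
    show "continuous_map (subtopology C (\<Phi> ` (U \<times> V))) (mtop N) (\<lambda>v. inv_into V \<psi> (R v))"
      by (simp add: o_def)
  qed
  have "homeomorphic_map (subtopology (prod_topology (mtop M) (mtop N)) (U \<times> V))
      (subtopology C (\<Phi> ` (U \<times> V))) \<Phi>"
    by (rule homeomorphic_map_chartI[OF UV cont inv]) (auto simp: chart_inv[OF M U] chart_inv[OF N V])
  then show "case z of (U, \<phi>) \<Rightarrow> openin (mtop (prod_manifold M N)) U \<and>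
      openin (coord_space (coords (prod_manifold M N))) (\<phi> ` U) \<and>
      homeomorphic_map (subtopology (mtop (prod_manifold M N)) U)
        (subtopology (coord_space (coords (prod_manifold M N))) (\<phi> ` U)) \<phi>"
    using UV openC unfolding z \<Phi>_def C_def I_def J_def by (simp add: prod_manifold_def)
qed

section \<open>Charts of powers of a manifold\<close>

context
  fixes M :: "('a, 'i) manifold" and n :: nat and c :: "nat \<Rightarrow> 'a set \<times> ('a \<Rightarrow> 'i \<Rightarrow> complex)" and \<Phi> P
  assumes M: "charted M" and c: "\<And>k. k < n \<Longrightarrow> c k \<in> atlas M"
  defines "\<Phi> \<equiv> \<lambda>x. \<lambda>(k, i)\<in>{..<n} \<times> coords M. snd (c k) (x k) i"
    and "P \<equiv> Pi\<^sub>E {..<n} (\<lambda>k. fst (c k))"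
begin

lemma chart_of_tuple: "k < n \<Longrightarrow> (fst (c k), snd (c k)) \<in> atlas M"
  using c by simp

text \<open>Charts have extensional values, so the \<open>k\<close>-th block of coordinates equals
  the value of the chart as a function, not merely on \<open>coords M\<close>.\<close>

lemma power_chart_component:
  assumes "x \<in> P" "k < n"
  shows "(\<lambda>i\<in>coords M. \<Phi> x (k, i)) = snd (c k) (x k)"
proof -
  have "x k \<in> fst (c k)" using assms by (auto simp: P_def)
  then have "snd (c k) (x k) \<in> extensional (coords M)"
    by (rule chart_extensional[OF M chart_of_tuple[OF assms(2)]])
  then show ?thesis using assms by (simp add: \<Phi>_def extensional_restrict cong: restrict_cong)
qed

lemma power_chart_open: "openin (product_topology (\<lambda>_. mtop M) {..<n}) P"
proof -
  have "openin (mtop M) (fst (c k))" if "k < n" for k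
    by (rule chart_open[OF M chart_of_tuple[OF that]])
  then show ?thesis by (simp add: P_def openin_PiE)
qed

text \<open>A preimage is found by inverting the chart in each entry. In this form the image is an
  intersection of finitely many preimages under block projections, hence open.\<close>

lemma power_chart_image: "\<Phi> ` P = {v \<in> extensional ({..<n} \<times> coords M).
    \<forall>k<n. (\<lambda>i\<in>coords M. v (k, i)) \<in> snd (c k) ` fst (c k)}"
proof (intro equalityI subsetI)
  fix v assume "v \<in> \<Phi> ` P"
  then obtain x where x: "x \<in> P" "v = \<Phi> x" by blast
  have "x k \<in> fst (c k)" if "k < n" for k using x(1) that by (auto simp: P_def)
  then show "v \<in> {v \<in> extensional ({..<n} \<times> coords M).
      \<forall>k<n. (\<lambda>i\<in>coords M. v (k, i)) \<in> snd (c k) ` fst (c k)}"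
    using x by (simp add: power_chart_component) (simp add: \<Phi>_def)
next
  fix v assume v: "v \<in> {v \<in> extensional ({..<n} \<times> coords M).
      \<forall>k<n. (\<lambda>i\<in>coords M. v (k, i)) \<in> snd (c k) ` fst (c k)}"
  define y where "y k = inv_into (fst (c k)) (snd (c k)) (\<lambda>i\<in>coords M. v (k, i))" for k
  have y: "y k \<in> fst (c k)" "snd (c k) (y k) = (\<lambda>i\<in>coords M. v (k, i))" if "k < n" for k
    using v that by (simp_all add: y_def inv_into_into f_inv_into_f)
  have "restrict y {..<n} \<in> P" using y by (auto simp: P_def)
  moreover have "v = \<Phi> (restrict y {..<n})"
  proof (rule extensionalityI[where A = "{..<n} \<times> coords M"])
    fix z assume "z \<in> {..<n} \<times> coords M"
    then obtain k i where "z = (k, i)" "k < n" "i \<in> coords M" by auto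
    then show "v z = \<Phi> (restrict y {..<n}) z"
      using fun_cong[OF y(2), of k i] by (simp add: \<Phi>_def)
  qed (use v in \<open>auto simp: \<Phi>_def\<close>)
  ultimately show "v \<in> \<Phi> ` P" by blast
qed

lemma power_chart_open_image: "openin (coord_space ({..<n} \<times> coords M)) (\<Phi> ` P)"
proof -
  let ?C = "coord_space ({..<n} \<times> coords M)"
  have "openin ?C {v \<in> topspace ?C. (\<lambda>i\<in>coords M. v (k, i)) \<in> snd (c k) ` fst (c k)}" if "k < n" for k
    by (rule openin_continuous_map_preimage[OF coord_space_continuous_reindex
        chart_open_image[OF M chart_of_tuple[OF that]]]) (use that in auto)
  \<comment> \<open>Intersecting with \<open>topspace ?C\<close> keeps \<open>n = 0\<close> correct,
    where the intersection over \<open>k\<close> is the whole type.\<close>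
  then have "openin ?C (topspace ?C \<inter>
      (\<Inter>k\<in>{..<n}. {v \<in> topspace ?C. (\<lambda>i\<in>coords M. v (k, i)) \<in> snd (c k) ` fst (c k)}))"
    by (intro openin_Int_Inter openin_topspace) auto
  also have "topspace ?C \<inter>
      (\<Inter>k\<in>{..<n}. {v \<in> topspace ?C. (\<lambda>i\<in>coords M. v (k, i)) \<in> snd (c k) ` fst (c k)}) = \<Phi> ` P"
    unfolding power_chart_image by auto
  finally show ?thesis .
qed

lemma power_chart_homeomorphic:
  "homeomorphic_map (subtopology (product_topology (\<lambda>_. mtop M) {..<n}) P)
     (subtopology (coord_space ({..<n} \<times> coords M)) (\<Phi> ` P)) \<Phi>"
proof (rule homeomorphic_map_chartI[OF power_chart_open])
  let ?C = "coord_space ({..<n} \<times> coords M)"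
  show "continuous_map (subtopology (product_topology (\<lambda>_. mtop M) {..<n}) P) ?C \<Phi>"
  proof (rule coord_space_continuousI)
    fix z assume "z \<in> {..<n} \<times> coords M"
    then obtain k i where z: "z = (k, i)" "k < n" "i \<in> coords M" by auto
    have "continuous_map (subtopology (product_topology (\<lambda>_. mtop M) {..<n}) P)
        (subtopology (mtop M) (fst (c k))) (\<lambda>x. x k)"
      unfolding continuous_map_in_subtopology
    proof
      show "continuous_map (subtopology (product_topology (\<lambda>_. mtop M) {..<n}) P) (mtop M) (\<lambda>x. x k)"
        using z(2) by (intro continuous_map_from_subtopology continuous_map_product_projection) simp
    qed (use z(2) in \<open>auto simp: P_def\<close>)
    from coord_space_continuous_component[OF
        continuous_map_compose[OF this chart_continuous[OF M chart_of_tuple[OF z(2)]]] z(3)]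
    show "continuous_map (subtopology (product_topology (\<lambda>_. mtop M) {..<n}) P) euclidean (\<lambda>x. \<Phi> x z)"
      using z by (simp add: \<Phi>_def)
  qed (simp add: \<Phi>_def)
  show "continuous_map (subtopology ?C (\<Phi> ` P)) (product_topology (\<lambda>_. mtop M) {..<n})
      (\<lambda>v. \<lambda>k\<in>{..<n}. inv_into (fst (c k)) (snd (c k)) (\<lambda>i\<in>coords M. v (k, i)))"
    unfolding continuous_map_componentwise
  proof (intro conjI ballI)
    fix k assume "k \<in> {..<n}"
    then have k: "k < n" by simp
    have "continuous_map (subtopology ?C (\<Phi> ` P)) (coord_space (coords M)) (\<lambda>v. \<lambda>i\<in>coords M. v (k, i))"
      by (rule continuous_map_from_subtopology[OF coord_space_continuous_reindex]) (use k in auto)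
    then have "continuous_map (subtopology ?C (\<Phi> ` P))
        (subtopology (coord_space (coords M)) (snd (c k) ` fst (c k))) (\<lambda>v. \<lambda>i\<in>coords M. v (k, i))"
      using k unfolding continuous_map_in_subtopology by (auto simp: power_chart_image)
    from continuous_map_compose[OF this chart_inv_continuous[OF M chart_of_tuple[OF k]]]
    show "continuous_map (subtopology ?C (\<Phi> ` P)) (mtop M)
        (\<lambda>v. (\<lambda>k\<in>{..<n}. inv_into (fst (c k)) (snd (c k)) (\<lambda>i\<in>coords M. v (k, i))) k)"
      using k by (simp add: o_def)
  qed auto
  show "(\<lambda>k\<in>{..<n}. inv_into (fst (c k)) (snd (c k)) (\<lambda>i\<in>coords M. \<Phi> x (k, i))) = x" if x: "x \<in> P" for x
  proof (rule extensionalityI[where A = "{..<n}"])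
    fix k assume "k \<in> {..<n}"
    then have k: "k < n" by simp
    have "x k \<in> fst (c k)" using x k by (auto simp: P_def)
    then have "inv_into (fst (c k)) (snd (c k)) (\<lambda>i\<in>coords M. \<Phi> x (k, i)) = x k"
      unfolding power_chart_component[OF x k] by (rule chart_inv[OF M chart_of_tuple[OF k]])
    then show "(\<lambda>k\<in>{..<n}. inv_into (fst (c k)) (snd (c k)) (\<lambda>i\<in>coords M. \<Phi> x (k, i))) k = x k"
      using k by simp
  next
    show "x \<in> extensional {..<n}" using x by (simp add: P_def PiE_def)
  qed (rule restrict_extensional)
qed

end

lemma charted_power:
  assumes M: "charted M"
  shows "charted (power_manifold M n)"
  unfolding charted_def
proof (intro conjI ballI)
  show "finite (coords (power_manifold M n))"
    using M by (simp add: charted_finite)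
  show "(\<Union>(U, \<phi>)\<in>atlas (power_manifold M n). U) = topspace (mtop (power_manifold M n))"
  proof (intro equalityI subsetI)
    fix x assume "x \<in> (\<Union>(U, \<phi>)\<in>atlas (power_manifold M n). U)"
    then obtain c where c: "\<And>k. k < n \<Longrightarrow> c k \<in> atlas M" "x \<in> Pi\<^sub>E {..<n} (\<lambda>k. fst (c k))"
      by (auto simp: power_manifold_def)
    from openin_subset[OF power_chart_open[OF M c(1)]] c(2)
    show "x \<in> topspace (mtop (power_manifold M n))" by (simp add: subset_iff)
  next
    fix x assume "x \<in> topspace (mtop (power_manifold M n))"
    then have x: "x \<in> extensional {..<n}" "\<And>k. k < n \<Longrightarrow> x k \<in> topspace (mtop M)"
      by (auto simp: PiE_def)
    have "\<exists>z. z \<in> atlas M \<and> x k \<in> fst z" if "k < n" for k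
      using charted_cover[OF M x(2)[OF that]] by (metis fst_conv)
    then obtain c where c: "\<And>k. k < n \<Longrightarrow> c k \<in> atlas M \<and> x k \<in> fst (c k)" by metis
    then have "x \<in> Pi\<^sub>E {..<n} (\<lambda>k. fst (c k))" using x by (auto simp: PiE_def)
    then show "x \<in> (\<Union>(U, \<phi>)\<in>atlas (power_manifold M n). U)"
      using c by (auto simp: power_manifold_def)
  qed
  fix z assume "z \<in> atlas (power_manifold M n)"
  then obtain c where c: "\<And>k. k < n \<Longrightarrow> c k \<in> atlas M"
    and z: "z = (Pi\<^sub>E {..<n} (\<lambda>k. fst (c k)), \<lambda>x. \<lambda>(k, i)\<in>{..<n} \<times> coords M. snd (c k) (x k) i)"
    by (auto simp: power_manifold_def)
  show "case z of (U, \<phi>) \<Rightarrow> openin (mtop (power_manifold M n)) U \<and>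
      openin (coord_space (coords (power_manifold M n))) (\<phi> ` U) \<and>
      homeomorphic_map (subtopology (mtop (power_manifold M n)) U)
        (subtopology (coord_space (coords (power_manifold M n))) (\<phi> ` U)) \<phi>"
    using power_chart_open[OF M c] power_chart_open_image[OF M c] power_chart_homeomorphic[OF M c]
    unfolding z by simp
qed

text \<open>The \<open>k\<close>-th factor of the power chart and the chart \<open>\<psi>\<close> of
  \<open>M\<close> may differ, so in coordinates the projection is a block projection followed by a
  transition map; hence \<open>complex_manifold\<close> and not just \<open>charted\<close>.\<close>

lemma holomorphic_map_component:
  assumes "complex_manifold M" and k: "k < n"
  shows "holomorphic_map (power_manifold M n) M (\<lambda>x. x k)"
  unfolding holomorphic_map_def
proof (rule holomorphic_map_onI)
  show "continuous_map (subtopology (mtop (power_manifold M n)) (topspace (mtop (power_manifold M n))))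
      (mtop M) (\<lambda>x. x k)"
    using k continuous_map_product_projection[of k "{..<n}" "\<lambda>_. mtop M"]
    by (intro continuous_map_from_subtopology) simp
next
  fix U \<phi> V \<psi> x j
  assume U: "(U, \<phi>) \<in> atlas (power_manifold M n)" and V: "(V, \<psi>) \<in> atlas M"
    and x: "x \<in> U" "x k \<in> V" "j \<in> coords M"
  have M: "charted M" by (rule complex_manifold_charted[OF assms(1)])
  obtain c where c: "\<And>k. k < n \<Longrightarrow> c k \<in> atlas M"
    and U_eq: "U = Pi\<^sub>E {..<n} (\<lambda>k. fst (c k))"
    and \<phi>_eq: "\<phi> = (\<lambda>x. \<lambda>(k, i)\<in>{..<n} \<times> coords M. snd (c k) (x k) i)"
    using U by (auto simp: power_manifold_def)
  define C where "C = coord_space ({..<n} \<times> coords M)"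
  define R where "R v = (\<lambda>i\<in>coords M. v (k, i))" for v :: "nat \<times> 'b \<Rightarrow> complex"
  have ck: "(fst (c k), snd (c k)) \<in> atlas M" using c[OF k] by simp
  have R: "R (\<phi> y) = snd (c k) (y k)" and yk: "y k \<in> fst (c k)" if "y \<in> U" for y
    using power_chart_component[OF M c _ k] that k unfolding R_def U_eq \<phi>_eq by auto
  have open_image: "openin C (\<phi> ` U)"
    unfolding C_def U_eq \<phi>_eq by (rule power_chart_open_image[OF M c])
  have cont: "continuous_map (subtopology C (\<phi> ` U)) (coord_space (coords M)) R"
    unfolding C_def R_def
    by (rule continuous_map_from_subtopology[OF coord_space_continuous_reindex]) (use k in auto)
  have transition: "complex_differentiable_at (coords M)
      (\<lambda>w. \<psi> (inv_into (fst (c k)) (snd (c k)) w) j) (snd (c k) (x k))"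
    using holomorphic_map_onD[OF holomorphic_map_id[OF assms(1), unfolded holomorphic_map_def] ck V]
      openin_subset[OF chart_open[OF M V]] yk[OF x(1)] x(2,3) by auto
  have "complex_differentiable_at ({..<n} \<times> coords M)
      (\<lambda>v. \<psi> (inv_into (fst (c k)) (snd (c k)) (R v)) j) (\<phi> x)"
  proof (rule complex_differentiable_at_compose[OF _ charted_finite[OF M] open_image[unfolded C_def] _
        cont[unfolded C_def]])
    show "complex_differentiable_at ({..<n} \<times> coords M) (\<lambda>v. R v i) (\<phi> x)" if "i \<in> coords M" for i
      using complex_differentiable_at_coord[of "{..<n} \<times> coords M" "(k, i)"] that k charted_finite[OF M]
      by (simp add: R_def)
    show "complex_differentiable_at (coords M) (\<lambda>w. \<psi> (inv_into (fst (c k)) (snd (c k)) w) j) (R (\<phi> x))"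
      using transition R[OF x(1)] by simp
  qed (use x charted_finite[OF M] in auto)
  then have "complex_differentiable_at ({..<n} \<times> coords M) (\<lambda>v. \<psi> (inv_into U \<phi> v k) j) (\<phi> x)"
  proof (rule complex_differentiable_at_cong[OF open_image[unfolded C_def], rotated 2])
    fix v assume "v \<in> \<phi> ` U"
    then obtain y where "y \<in> U" "v = \<phi> y" by blast
    then show "\<psi> (inv_into (fst (c k)) (snd (c k)) (R v)) j = \<psi> (inv_into U \<phi> v k) j"
      by (simp add: R yk chart_inv[OF charted_power[OF M] U] chart_inv[OF M ck])
  qed (use x in auto)
  then show "complex_differentiable_at (coords (power_manifold M n)) (\<lambda>v. \<psi> (inv_into U \<phi> v k) j) (\<phi> x)"
    by simp
qed (rule openin_topspace)

text \<open>Preimages of open sets are generators of the Borel algebra of the source. Holomorphic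
  maps thereby satisfy the measurability condition on cochains.\<close>

lemma measurable_borel_algebra:
  assumes "continuous_map X Y f"
  shows "f \<in> borel_algebra X \<rightarrow>\<^sub>M borel_algebra Y"
  unfolding borel_algebra_def
proof (rule measurable_measure_of)
  have Pow: "{U. openin X U} \<subseteq> Pow (topspace X)" using openin_subset by blast
  show "{U. openin Y U} \<subseteq> Pow (topspace Y)" using openin_subset by blast
  show "f \<in> space (sigma (topspace X) {U. openin X U}) \<rightarrow> topspace Y"
    using continuous_map_image_subset_topspace[OF assms] by (auto simp: space_measure_of[OF Pow])
  fix V assume "V \<in> {U. openin Y U}"
  then have "openin X {x \<in> topspace X. f x \<in> V}"
    using openin_continuous_map_preimage[OF assms] by blast
  moreover have "f -` V \<inter> topspace X = {x \<in> topspace X. f x \<in> V}" by blast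
  ultimately show "f -` V \<inter> space (sigma (topspace X) {U. openin X U}) \<in> sets (sigma (topspace X) {U. openin X U})"
    by (simp add: space_measure_of[OF Pow] sets_measure_of[OF Pow] sigma_sets.Basic)
qed


section \<open>Lie groups\<close>

lemma complex_lie_group_charted: "complex_lie_group L \<Longrightarrow> charted (mfd L)"
  by (simp add: complex_lie_group_def complex_manifold_charted)

lemma holomorphic_map_mult:
  assumes L: "complex_lie_group L" and M: "charted M"
    and "holomorphic_map M (mfd L) f" "holomorphic_map M (mfd L) g"
  shows "holomorphic_map M (mfd L) (\<lambda>x. f x \<otimes>\<^bsub>L\<^esub> g x)"
proof -
  have "holomorphic_map (prod_manifold (mfd L) (mfd L)) (mfd L) (\<lambda>(x, y). x \<otimes>\<^bsub>L\<^esub> y)"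
    using L by (simp add: complex_lie_group_def)
  from holomorphic_map_compose[OF M charted_prod holomorphic_map_pair[OF assms(3,4)] this]
  show ?thesis using complex_lie_group_charted[OF L] by simp
qed

lemma holomorphic_map_inv:
  assumes L: "complex_lie_group L" and M: "charted M" and "holomorphic_map M (mfd L) f"
  shows "holomorphic_map M (mfd L) (\<lambda>x. inv\<^bsub>L\<^esub> f x)"
proof -
  have "holomorphic_map (mfd L) (mfd L) (\<lambda>x. inv\<^bsub>L\<^esub> x)"
    using L by (simp add: complex_lie_group_def)
  then show ?thesis
    by (rule holomorphic_map_compose[OF M complex_lie_group_charted[OF L] assms(3)])
qed

lemma complex_lie_group_id: "complex_lie_group L \<Longrightarrow> holomorphic_map (mfd L) (mfd L) (\<lambda>x. x)"
  by (simp add: complex_lie_group_def holomorphic_map_id)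


section \<open>Crossed homomorphisms and 1-cocycles\<close>

context
  fixes G :: "('g, 'i) lie_group" and A :: "('a, 'j) lie_group" and \<rho> :: "'g \<Rightarrow> 'a \<Rightarrow> 'a"
  assumes G: "complex_lie_group G" and module: "holomorphic_module G A \<rho>"
begin

lemma module_lie_group: "complex_lie_group A"
  using module by (simp add: holomorphic_module_def)

interpretation G: group G
  using G by (simp add: complex_lie_group_def)

interpretation A: comm_group A
  using module by (simp add: holomorphic_module_def)

lemma topspace_mfd [simp]: "topspace (mtop (mfd G)) = carrier G" "topspace (mtop (mfd A)) = carrier A"
  using G module_lie_group by (simp_all add: complex_lie_group_def)

lemma charted_mfd [simp]: "charted (mfd G)" "charted (mfd A)"
  using G module_lie_group by (simp_all add: complex_lie_group_charted)

section \<open>The action by automorphisms\<close>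

lemma holomorphic_map_act:
  assumes M: "charted M" and "holomorphic_map M (mfd G) f" "holomorphic_map M (mfd A) g"
  shows "holomorphic_map M (mfd A) (\<lambda>x. \<rho> (f x) (g x))"
proof -
  have "holomorphic_map (prod_manifold (mfd G) (mfd A)) (mfd A) (\<lambda>(s, a). \<rho> s a)"
    using module by (simp add: holomorphic_module_def)
  from holomorphic_map_compose[OF M charted_prod holomorphic_map_pair[OF assms(2,3)] this]
  show ?thesis by simp
qed

lemma act_automorphism: "s \<in> carrier G \<Longrightarrow> \<rho> s \<in> hom A A \<inter> Bij (carrier A)"
  using module by (auto simp: holomorphic_module_def hom_def AutoGroup_def auto_def)

lemma act_closed [simp]: "s \<in> carrier G \<Longrightarrow> a \<in> carrier A \<Longrightarrow> \<rho> s a \<in> carrier A"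
  using act_automorphism[of s] by (auto simp: hom_def)

lemma act_mult [simp]: "s \<in> carrier G \<Longrightarrow> a \<in> carrier A \<Longrightarrow> b \<in> carrier A \<Longrightarrow>
    \<rho> s (a \<otimes>\<^bsub>A\<^esub> b) = \<rho> s a \<otimes>\<^bsub>A\<^esub> \<rho> s b"
  using act_automorphism[of s] by (auto simp: hom_def)

lemma act_hom: "s \<in> carrier G \<Longrightarrow> group_hom A A (\<rho> s)"
  using act_automorphism[of s] by (simp add: group_hom_def group_hom_axioms_def A.is_group)

lemma act_one [simp]: "s \<in> carrier G \<Longrightarrow> \<rho> s \<one>\<^bsub>A\<^esub> = \<one>\<^bsub>A\<^esub>"
  using group_hom.hom_one[OF act_hom] by simp

lemma act_inv [simp]: "s \<in> carrier G \<Longrightarrow> a \<in> carrier A \<Longrightarrow> \<rho> s (inv\<^bsub>A\<^esub> a) = inv\<^bsub>A\<^esub> \<rho> s a"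
  using group_hom.hom_inv[OF act_hom] by simp

lemma act_act:
  assumes "s \<in> carrier G" "t \<in> carrier G" "a \<in> carrier A"
  shows "\<rho> (s \<otimes>\<^bsub>G\<^esub> t) a = \<rho> s (\<rho> t a)"
proof -
  have "\<rho> (s \<otimes>\<^bsub>G\<^esub> t) = \<rho> s \<otimes>\<^bsub>AutoGroup A\<^esub> \<rho> t"
    using module assms by (simp add: holomorphic_module_def hom_def)
  \<comment> \<open>\<open>AutoGroup A\<close> takes its multiplication from
    \<open>BijGroup\<close>, where it is composition restricted to the carrier.\<close>
  also have "\<dots> = compose (carrier A) (\<rho> s) (\<rho> t)"
    using act_automorphism assms by (simp add: AutoGroup_def BijGroup_def)
  finally show ?thesis using assms by (simp add: compose_def)
qed

text \<open>Crossed homomorphisms satisfy \<open>c t = c s + s \<cdot> c (s\<^sup>-\<^sup>1 t)\<close>; for \<open>t\<close> near \<open>s\<close> the right-hand side only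
  involves values of \<open>c\<close> near the identity.\<close>

lemma crossed_hom_holomorphic:
  assumes c: "c \<in> carrier G \<rightarrow> carrier A"
    and crossed: "\<And>s t. \<lbrakk>s \<in> carrier G; t \<in> carrier G\<rbrakk> \<Longrightarrow> c (s \<otimes>\<^bsub>G\<^esub> t) = c s \<otimes>\<^bsub>A\<^esub> \<rho> s (c t)"
    and W: "\<one>\<^bsub>G\<^esub> \<in> W" "holomorphic_map_on W (mfd G) (mfd A) c"
  shows "holomorphic_map (mfd G) (mfd A) c"
proof (rule holomorphic_map_local, unfold topspace_mfd)
  fix s assume s: "s \<in> carrier G"
  \<comment> \<open>Left translation moving \<open>s\<close> to the identity, near which
    \<open>c\<close> is holomorphic.\<close>
  define \<tau> where "\<tau> = (\<lambda>t. inv\<^bsub>G\<^esub> s \<otimes>\<^bsub>G\<^esub> t)"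
  have "holomorphic_map (mfd G) (mfd G) \<tau>"
    unfolding \<tau>_def using s
    by (intro holomorphic_map_mult[OF G] holomorphic_map_const complex_lie_group_id[OF G]) simp_all
  from holomorphic_map_on_compose[OF charted_mfd(1) charted_mfd(1) this[unfolded holomorphic_map_def] W(2)]
  have 1: "holomorphic_map_on (carrier G \<inter> \<tau> -` W) (mfd G) (mfd A) (\<lambda>t. c (\<tau> t))" by simp
  have "holomorphic_map (mfd A) (mfd A) (\<lambda>a. c s \<otimes>\<^bsub>A\<^esub> \<rho> s a)"
    using s c by (intro holomorphic_map_mult[OF module_lie_group] holomorphic_map_act holomorphic_map_const
        complex_lie_group_id[OF module_lie_group]) auto
  from holomorphic_map_on_compose[OF charted_mfd 1 this[unfolded holomorphic_map_def]]
  \<comment> \<open>The domain is the one produced by the composition rule: an open neighbourhood of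
    \<open>s\<close> on which \<open>\<tau> t\<close> stays in \<open>W\<close>.\<close>
  have 2: "holomorphic_map_on (carrier G \<inter> \<tau> -` W \<inter> (\<lambda>t. c (\<tau> t)) -` carrier A) (mfd G) (mfd A)
      (\<lambda>t. c s \<otimes>\<^bsub>A\<^esub> \<rho> s (c (\<tau> t)))" by simp
  have eq: "c s \<otimes>\<^bsub>A\<^esub> \<rho> s (c (\<tau> t)) = c t" if "t \<in> carrier G" for t
  proof -
    have "s \<otimes>\<^bsub>G\<^esub> \<tau> t = t"
      using s that by (simp add: \<tau>_def G.m_assoc[symmetric])
    then show ?thesis using crossed[of s "\<tau> t"] s that by (simp add: \<tau>_def)
  qed
  have "holomorphic_map_on (carrier G \<inter> \<tau> -` W \<inter> (\<lambda>t. c (\<tau> t)) -` carrier A) (mfd G) (mfd A) c"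
    by (rule holomorphic_map_on_cong[OF charted_mfd 2]) (rule eq, blast)
  moreover have "s \<in> carrier G \<inter> \<tau> -` W \<inter> (\<lambda>t. c (\<tau> t)) -` carrier A"
    using s W(1) funcset_mem[OF c] by (simp add: \<tau>_def)
  ultimately show "\<exists>W. s \<in> W \<and> holomorphic_map_on W (mfd G) (mfd A) c"
    by (intro exI conjI)
qed

section \<open>The group of holomorphic crossed homomorphisms\<close>

lemma crossed_homs_simps:
  "c \<in> carrier (holomorphic_crossed_homs G A \<rho>) \<longleftrightarrow> c \<in> carrier G \<rightarrow>\<^sub>E carrier A \<and>
     holomorphic_map (mfd G) (mfd A) c \<and>
     (\<forall>s\<in>carrier G. \<forall>t\<in>carrier G. c (s \<otimes>\<^bsub>G\<^esub> t) = c s \<otimes>\<^bsub>A\<^esub> \<rho> s (c t))"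
  "c \<otimes>\<^bsub>holomorphic_crossed_homs G A \<rho>\<^esub> c' = (\<lambda>s\<in>carrier G. c s \<otimes>\<^bsub>A\<^esub> c' s)"
  "\<one>\<^bsub>holomorphic_crossed_homs G A \<rho>\<^esub> = (\<lambda>s\<in>carrier G. \<one>\<^bsub>A\<^esub>)"
  by (simp_all add: holomorphic_crossed_homs_def)

text \<open>Elements of the group are extensional, so pointwise formulas enter it through
  \<open>restrict\<close>. Holomorphy depends only on values on \<open>carrier G\<close> and
  survives the restriction.\<close>

lemma crossed_homI:
  assumes "holomorphic_map (mfd G) (mfd A) c"
    and "\<And>s t. \<lbrakk>s \<in> carrier G; t \<in> carrier G\<rbrakk> \<Longrightarrow> c (s \<otimes>\<^bsub>G\<^esub> t) = c s \<otimes>\<^bsub>A\<^esub> \<rho> s (c t)"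
  shows "restrict c (carrier G) \<in> carrier (holomorphic_crossed_homs G A \<rho>)"
proof -
  have "holomorphic_map (mfd G) (mfd A) (restrict c (carrier G))"
    by (rule holomorphic_map_cong[OF _ _ assms(1)]) simp_all
  then show ?thesis
    using assms holomorphic_map_in[OF assms(1)] by (simp add: crossed_homs_simps)
qed

lemma crossed_hom_closed [simp]:
  "c \<in> carrier (holomorphic_crossed_homs G A \<rho>) \<Longrightarrow> s \<in> carrier G \<Longrightarrow> c s \<in> carrier A"
  by (auto simp: crossed_homs_simps)

lemma crossed_hom_extensional:
  "c \<in> carrier (holomorphic_crossed_homs G A \<rho>) \<Longrightarrow> c \<in> extensional (carrier G)"
  by (simp add: crossed_homs_simps PiE_def)

text \<open>Since \<open>A\<close> is abelian and each \<open>\<rho> s\<close> is a homomorphism,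
  pointwise products and inverses keep the crossed homomorphism identity; they stay holomorphic
  because the operations of \<open>A\<close> are.\<close>

lemma crossed_homs_comm_group: "comm_group (holomorphic_crossed_homs G A \<rho>)" (is "comm_group ?Z")
proof (rule comm_groupI)
  fix c c' assume c: "c \<in> carrier ?Z" and c': "c' \<in> carrier ?Z"
  show "c \<otimes>\<^bsub>?Z\<^esub> c' \<in> carrier ?Z"
    unfolding crossed_homs_simps(2)
  proof (rule crossed_homI)
    show "holomorphic_map (mfd G) (mfd A) (\<lambda>s. c s \<otimes>\<^bsub>A\<^esub> c' s)"
      using c c' by (intro holomorphic_map_mult[OF module_lie_group]) (simp_all add: crossed_homs_simps)
    show "c (s \<otimes>\<^bsub>G\<^esub> t) \<otimes>\<^bsub>A\<^esub> c' (s \<otimes>\<^bsub>G\<^esub> t) = c s \<otimes>\<^bsub>A\<^esub> c' s \<otimes>\<^bsub>A\<^esub> \<rho> s (c t \<otimes>\<^bsub>A\<^esub> c' t)"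
      if "s \<in> carrier G" "t \<in> carrier G" for s t
    proof -
      have "c (s \<otimes>\<^bsub>G\<^esub> t) = c s \<otimes>\<^bsub>A\<^esub> \<rho> s (c t)" "c' (s \<otimes>\<^bsub>G\<^esub> t) = c' s \<otimes>\<^bsub>A\<^esub> \<rho> s (c' t)"
        using c c' that by (simp_all add: crossed_homs_simps)
      then show ?thesis using c c' that by (simp add: A.m_ac)
    qed
  qed
  show "c \<otimes>\<^bsub>?Z\<^esub> c' = c' \<otimes>\<^bsub>?Z\<^esub> c"
    using c c' by (auto simp: crossed_homs_simps(2) A.m_comm intro: restrict_ext)
next
  show "\<one>\<^bsub>?Z\<^esub> \<in> carrier ?Z"
    unfolding crossed_homs_simps(3) by (rule crossed_homI) (simp_all add: holomorphic_map_const)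
next
  fix c assume c: "c \<in> carrier ?Z"
  then have "c \<in> extensional (carrier G)" by (rule crossed_hom_extensional)
  then show "\<one>\<^bsub>?Z\<^esub> \<otimes>\<^bsub>?Z\<^esub> c = c"
    using c by (intro extensionalityI[where A = "carrier G"]) (auto simp: crossed_homs_simps(2,3))
  have "(\<lambda>s\<in>carrier G. inv\<^bsub>A\<^esub> c s) \<in> carrier ?Z"
  proof (rule crossed_homI)
    show "holomorphic_map (mfd G) (mfd A) (\<lambda>s. inv\<^bsub>A\<^esub> c s)"
      using c by (intro holomorphic_map_inv[OF module_lie_group]) (simp_all add: crossed_homs_simps)
    show "inv\<^bsub>A\<^esub> c (s \<otimes>\<^bsub>G\<^esub> t) = inv\<^bsub>A\<^esub> c s \<otimes>\<^bsub>A\<^esub> \<rho> s (inv\<^bsub>A\<^esub> c t)"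
      if "s \<in> carrier G" "t \<in> carrier G" for s t
    proof -
      have "c (s \<otimes>\<^bsub>G\<^esub> t) = c s \<otimes>\<^bsub>A\<^esub> \<rho> s (c t)"
        using c that by (simp add: crossed_homs_simps)
      then show ?thesis using c that by (simp add: A.inv_mult)
    qed
  qed
  moreover have "(\<lambda>s\<in>carrier G. inv\<^bsub>A\<^esub> c s) \<otimes>\<^bsub>?Z\<^esub> c = \<one>\<^bsub>?Z\<^esub>"
    using c by (auto simp: crossed_homs_simps(2,3) A.l_inv intro: restrict_ext)
  ultimately show "\<exists>d\<in>carrier ?Z. d \<otimes>\<^bsub>?Z\<^esub> c = \<one>\<^bsub>?Z\<^esub>" by blast
next
  fix c c' c'' assume "c \<in> carrier ?Z" "c' \<in> carrier ?Z" "c'' \<in> carrier ?Z"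
  then show "c \<otimes>\<^bsub>?Z\<^esub> c' \<otimes>\<^bsub>?Z\<^esub> c'' = c \<otimes>\<^bsub>?Z\<^esub> (c' \<otimes>\<^bsub>?Z\<^esub> c'')"
    by (auto simp: crossed_homs_simps(2) A.m_assoc intro: restrict_ext)
qed

text \<open>Additively the identity telescopes: (s a - a) + s (t a - a) = s t a - a. Holomorphy is
  that of the action with its second argument fixed.\<close>

lemma principal_crossed_hom:
  assumes a: "a \<in> carrier A"
  shows "(\<lambda>s\<in>carrier G. \<rho> s a \<otimes>\<^bsub>A\<^esub> inv\<^bsub>A\<^esub> a) \<in> carrier (holomorphic_crossed_homs G A \<rho>)"
proof (rule crossed_homI)
  have "complex_manifold (mfd G)" using G by (simp add: complex_lie_group_def)
  then show "holomorphic_map (mfd G) (mfd A) (\<lambda>s. \<rho> s a \<otimes>\<^bsub>A\<^esub> inv\<^bsub>A\<^esub> a)"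
    using a by (intro holomorphic_map_mult[OF module_lie_group] holomorphic_map_act holomorphic_map_const
        holomorphic_map_id) simp_all
  fix s t assume st: "s \<in> carrier G" "t \<in> carrier G"
  \<comment> \<open>Exchanges the two inverse factors, so that \<open>\<rho> s a\<close> meets its
    own inverse and cancels.\<close>
  have eq: "\<rho> s a \<otimes>\<^bsub>A\<^esub> inv\<^bsub>A\<^esub> a \<otimes>\<^bsub>A\<^esub> \<rho> s (\<rho> t a \<otimes>\<^bsub>A\<^esub> inv\<^bsub>A\<^esub> a) =
      \<rho> s a \<otimes>\<^bsub>A\<^esub> inv\<^bsub>A\<^esub> \<rho> s a \<otimes>\<^bsub>A\<^esub> (\<rho> s (\<rho> t a) \<otimes>\<^bsub>A\<^esub> inv\<^bsub>A\<^esub> a)"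
  proof -
    have "x \<otimes>\<^bsub>A\<^esub> b \<otimes>\<^bsub>A\<^esub> (y \<otimes>\<^bsub>A\<^esub> z) = x \<otimes>\<^bsub>A\<^esub> z \<otimes>\<^bsub>A\<^esub> (y \<otimes>\<^bsub>A\<^esub> b)"
      if "x \<in> carrier A" "b \<in> carrier A" "y \<in> carrier A" "z \<in> carrier A" for x b y z
      using that by (simp add: A.m_ac)
    from this[of "\<rho> s a" "inv\<^bsub>A\<^esub> a" "\<rho> s (\<rho> t a)" "inv\<^bsub>A\<^esub> \<rho> s a"]
    show ?thesis using st a by simp
  qed
  show "\<rho> (s \<otimes>\<^bsub>G\<^esub> t) a \<otimes>\<^bsub>A\<^esub> inv\<^bsub>A\<^esub> a =
      \<rho> s a \<otimes>\<^bsub>A\<^esub> inv\<^bsub>A\<^esub> a \<otimes>\<^bsub>A\<^esub> \<rho> s (\<rho> t a \<otimes>\<^bsub>A\<^esub> inv\<^bsub>A\<^esub> a)"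
    unfolding eq using st a by (simp add: act_act A.r_inv)
qed

text \<open>The map \<open>p\<close> is a homomorphism from \<open>A\<close>, so its image is a
  subgroup, and the ambient group is abelian.\<close>

lemma principal_crossed_homs_normal:
  "principal_crossed_homs G A \<rho> \<lhd> holomorphic_crossed_homs G A \<rho>" (is "?P \<lhd> ?Z")
proof -
  interpret Z: comm_group ?Z by (rule crossed_homs_comm_group)
  define p where "p a = (\<lambda>s\<in>carrier G. \<rho> s a \<otimes>\<^bsub>A\<^esub> inv\<^bsub>A\<^esub> a)" for a
  have P: "?P = p ` carrier A" by (auto simp: principal_crossed_homs_def p_def)
  have p: "p a \<in> carrier ?Z" if "a \<in> carrier A" for a
    using principal_crossed_hom[OF that] by (simp add: p_def)
  have mult: "p a \<otimes>\<^bsub>?Z\<^esub> p b = p (a \<otimes>\<^bsub>A\<^esub> b)" if "a \<in> carrier A" "b \<in> carrier A" for a b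
    unfolding crossed_homs_simps(2) p_def using that
    by (intro restrict_ext) (simp add: A.inv_mult A.m_ac)
  have one: "p \<one>\<^bsub>A\<^esub> = \<one>\<^bsub>?Z\<^esub>"
    unfolding crossed_homs_simps(3) p_def by (intro restrict_ext) simp
  have "subgroup ?P ?Z"
  proof (rule Z.subgroupI)
    show "?P \<subseteq> carrier ?Z" "?P \<noteq> {}" using p by (auto simp: P)
  next
    fix c assume "c \<in> ?P"
    then obtain a where a: "a \<in> carrier A" "c = p a" by (auto simp: P)
    have "inv\<^bsub>?Z\<^esub> c = p (inv\<^bsub>A\<^esub> a)"
      using a by (intro Z.inv_equality) (simp_all add: mult one p A.l_inv)
    then show "inv\<^bsub>?Z\<^esub> c \<in> ?P" using a by (simp add: P)
  next
    fix c c' assume "c \<in> ?P" "c' \<in> ?P"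
    then show "c \<otimes>\<^bsub>?Z\<^esub> c' \<in> ?P" by (auto simp: P mult)
  qed
  then show ?thesis by (rule Z.subgroup_imp_normal)
qed

section \<open>Cocycles and coboundaries of degree 1\<close>

abbreviation single :: "'g \<Rightarrow> nat \<Rightarrow> 'g" where
  "single x \<equiv> (\<lambda>_\<in>{..<1}. x)"

lemma single_tuples: "x \<in> carrier G \<Longrightarrow> single x \<in> tuples G 1"
  by (simp add: tuples_def)

lemma tuples_1_eq_single:
  assumes "s \<in> tuples G 1"
  shows "single (s 0) = s"
proof (rule extensionalityI[where A = "{..<1}"])
  show "s \<in> extensional {..<1}" using assms by (simp add: tuples_def PiE_def)
qed simp_all

lemma as_cochain_single: "x \<in> carrier G \<Longrightarrow> as_cochain G c (single x) = c x"
  using single_tuples[of x] by (simp add: as_cochain_def)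

text \<open>A 1-tuple is determined by its entry 0; extensionality of \<open>f\<close> settles the
  values outside \<open>tuples G 1\<close>.\<close>

lemma as_cochain_of_single:
  assumes "f \<in> extensional (tuples G 1)"
  shows "as_cochain G (\<lambda>x\<in>carrier G. f (single x)) = f"
proof (rule extensionalityI[where A = "tuples G 1"])
  fix s assume s: "s \<in> tuples G 1"
  then have "s 0 \<in> carrier G" by (auto simp: tuples_def)
  then show "as_cochain G (\<lambda>x\<in>carrier G. f (single x)) s = f s"
    using s tuples_1_eq_single[OF s] by (simp add: as_cochain_def)
next
  show "as_cochain G (\<lambda>x\<in>carrier G. f (single x)) \<in> extensional (tuples G 1)"
    unfolding as_cochain_def by (rule restrict_extensional)
qed (rule assms)

text \<open>For \<open>n = 1\<close> the middle product has a single factor, which merges entries 0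
  and 1 and has exponent -1; the last exponent is (-1)^2 = 1.\<close>

lemma coboundary_1:
  assumes f: "f \<in> tuples G 1 \<rightarrow> carrier A" and s: "s \<in> tuples G (1 + 1)"
  shows "coboundary G A \<rho> 1 f s =
    \<rho> (s 0) (f (single (s 1))) \<otimes>\<^bsub>A\<^esub> inv\<^bsub>A\<^esub> f (single (s 0 \<otimes>\<^bsub>G\<^esub> s 1)) \<otimes>\<^bsub>A\<^esub> f (single (s 0))"
proof -
  have s01: "s 0 \<in> carrier G" "s 1 \<in> carrier G" using s by (auto simp: tuples_def)
  have f': "f (single x) \<in> carrier A" if "x \<in> carrier G" for x
    using f single_tuples[OF that] by blast
  have eqs: "(\<lambda>j\<in>{..<1}. s (Suc j)) = single (s 1)" "merge_at G 1 1 s = single (s 0 \<otimes>\<^bsub>G\<^esub> s 1)"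
      "restrict s {..<1} = single (s 0)"
    by (auto simp: merge_at_def intro: restrict_ext)
  have "(\<Otimes>\<^bsub>A\<^esub>i\<in>{1..1}. f (merge_at G 1 i s) [^]\<^bsub>A\<^esub> ((-1) ^ i :: int)) =
      inv\<^bsub>A\<^esub> f (single (s 0 \<otimes>\<^bsub>G\<^esub> s 1))"
    using f'[of "s 0 \<otimes>\<^bsub>G\<^esub> s 1"] s01 eqs(2) by (simp add: A.int_pow_neg A.int_pow_1)
  then show ?thesis
    using s s01 f' unfolding coboundary_def by (simp add: eqs[simplified] A.int_pow_1)
qed

text \<open>In the abelian group \<open>A\<close>, s f(t) - f(st) + f(s) = 0 can be solved for
  f(st), and every pair of group elements occurs as a 2-tuple.\<close>

lemma cocycle_condition:
  assumes f: "f \<in> tuples G 1 \<rightarrow> carrier A"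
  shows "coboundary G A \<rho> 1 f = \<one>\<^bsub>cochains G A (1 + 1)\<^esub> \<longleftrightarrow>
    (\<forall>s\<in>carrier G. \<forall>t\<in>carrier G. f (single (s \<otimes>\<^bsub>G\<^esub> t)) = f (single s) \<otimes>\<^bsub>A\<^esub> \<rho> s (f (single t)))"
    (is "?L \<longleftrightarrow> ?R")
proof -
  have f': "f (single x) \<in> carrier A" if "x \<in> carrier G" for x
    using f single_tuples[OF that] by blast
  have iff: "\<rho> s (f (single t)) \<otimes>\<^bsub>A\<^esub> inv\<^bsub>A\<^esub> f (single (s \<otimes>\<^bsub>G\<^esub> t)) \<otimes>\<^bsub>A\<^esub> f (single s) = \<one>\<^bsub>A\<^esub> \<longleftrightarrow>
      f (single (s \<otimes>\<^bsub>G\<^esub> t)) = f (single s) \<otimes>\<^bsub>A\<^esub> \<rho> s (f (single t))"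
    if "s \<in> carrier G" "t \<in> carrier G" for s t
  proof -
    have *: "x \<otimes>\<^bsub>A\<^esub> inv\<^bsub>A\<^esub> y \<otimes>\<^bsub>A\<^esub> z = \<one>\<^bsub>A\<^esub> \<longleftrightarrow> y = z \<otimes>\<^bsub>A\<^esub> x"
      if "x \<in> carrier A" "y \<in> carrier A" "z \<in> carrier A" for x y z
    proof -
      have "x \<otimes>\<^bsub>A\<^esub> inv\<^bsub>A\<^esub> y \<otimes>\<^bsub>A\<^esub> z = z \<otimes>\<^bsub>A\<^esub> x \<otimes>\<^bsub>A\<^esub> inv\<^bsub>A\<^esub> y"
        using that by (simp add: A.m_ac)
      then show ?thesis
        using that A.inv_solve_right'[of "\<one>\<^bsub>A\<^esub>" "z \<otimes>\<^bsub>A\<^esub> x" y] by (simp add: eq_commute)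
    qed
    show ?thesis using that by (intro *) (simp_all add: f' del: One_nat_def)
  qed
  show ?thesis
  proof
    assume L: ?L
    show ?R
    proof (intro ballI)
      fix s t assume st: "s \<in> carrier G" "t \<in> carrier G"
      \<comment> \<open>The pair \<open>(s, t)\<close> as a 2-tuple, at which the hypothesis is
        evaluated.\<close>
      define u where "u = (\<lambda>j\<in>{..<1 + 1 :: nat}. if j = 0 then s else t)"
      have u: "u \<in> tuples G (1 + 1)" "u 0 = s" "u 1 = t"
        using st by (auto simp: u_def tuples_def)
      have "coboundary G A \<rho> 1 f u = \<one>\<^bsub>A\<^esub>"
        using fun_cong[OF L, of u] u(1) by (simp add: cochains_def)
      then show "f (single (s \<otimes>\<^bsub>G\<^esub> t)) = f (single s) \<otimes>\<^bsub>A\<^esub> \<rho> s (f (single t))"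
        unfolding coboundary_1[OF f u(1)] u(2,3) iff[OF st] .
    qed
  next
    assume R: ?R
    show ?L
    proof (rule extensionalityI[where A = "tuples G (1 + 1)"])
      fix u assume u: "u \<in> tuples G (1 + 1)"
      then have u01: "u 0 \<in> carrier G" "u 1 \<in> carrier G" by (auto simp: tuples_def)
      have "coboundary G A \<rho> 1 f u = \<one>\<^bsub>A\<^esub>"
        unfolding coboundary_1[OF f u] iff[OF u01] using R u01 by blast
      then show "coboundary G A \<rho> 1 f u = \<one>\<^bsub>cochains G A (1 + 1)\<^esub> u"
        using u by (simp add: cochains_def)
    qed (simp_all add: coboundary_def cochains_def)
  qed
qed

text \<open>On 1-tuples the cochain is \<open>c\<close> after the projection to entry 0, hence
  holomorphic on the whole first power. Measurability follows by continuity, and the whole space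
  serves as the neighbourhood of the identity.\<close>

lemma as_cochain_cocycle:
  assumes c: "c \<in> carrier (holomorphic_crossed_homs G A \<rho>)"
  shows "as_cochain G c \<in> carrier (cocycles G A \<rho> 1)"
proof -
  have range: "as_cochain G c \<in> tuples G 1 \<rightarrow>\<^sub>E carrier A"
  proof (rule PiE_I)
    fix s assume s: "s \<in> tuples G 1"
    then have "s 0 \<in> carrier G" by (auto simp: tuples_def)
    then show "as_cochain G c s \<in> carrier A"
      using s c by (simp only: as_cochain_def restrict_apply' crossed_hom_closed)
  qed (simp add: as_cochain_def)
  have top: "topspace (mtop (power_manifold (mfd G) 1)) = tuples G 1"
    by (simp add: tuples_def)
  have "complex_manifold (mfd G)" using G by (simp add: complex_lie_group_def)
  then have "holomorphic_map (power_manifold (mfd G) 1) (mfd G) (\<lambda>x. x 0)"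
    by (intro holomorphic_map_component) simp_all
  moreover have "holomorphic_map (mfd G) (mfd A) c"
    using c by (simp add: crossed_homs_simps(1))
  ultimately have "holomorphic_map (power_manifold (mfd G) 1) (mfd A) (\<lambda>x. c (x 0))"
    by (rule holomorphic_map_compose[OF charted_power[OF charted_mfd(1)] charted_mfd(1)])
  then have hol: "holomorphic_map (power_manifold (mfd G) 1) (mfd A) (as_cochain G c)"
    by (rule holomorphic_map_cong[OF charted_power[OF charted_mfd(1)] charted_mfd(2)])
      (simp only: top as_cochain_def restrict_apply')
  have "locally_holomorphic_at_one G A 1 (as_cochain G c)"
    unfolding locally_holomorphic_at_one_def
    using hol[unfolded holomorphic_map_def top] single_tuples[OF G.one_closed]
    by (intro exI[of _ "tuples G 1"] conjI)
  moreover have "as_cochain G c \<in>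
      borel_algebra (mtop (power_manifold (mfd G) 1)) \<rightarrow>\<^sub>M borel_algebra (mtop (mfd A))"
    by (rule measurable_borel_algebra[OF holomorphic_map_continuous[OF hol]])
  moreover have "coboundary G A \<rho> 1 (as_cochain G c) = \<one>\<^bsub>cochains G A (1 + 1)\<^esub>"
  proof (subst cocycle_condition)
    show "as_cochain G c \<in> tuples G 1 \<rightarrow> carrier A" using range by auto
    show "\<forall>s\<in>carrier G. \<forall>t\<in>carrier G. as_cochain G c (single (s \<otimes>\<^bsub>G\<^esub> t)) =
        as_cochain G c (single s) \<otimes>\<^bsub>A\<^esub> \<rho> s (as_cochain G c (single t))"
    proof (intro ballI)
      fix s t assume st: "s \<in> carrier G" "t \<in> carrier G"
      have "c (s \<otimes>\<^bsub>G\<^esub> t) = c s \<otimes>\<^bsub>A\<^esub> \<rho> s (c t)"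
        using c st by (simp add: crossed_homs_simps(1))
      then show "as_cochain G c (single (s \<otimes>\<^bsub>G\<^esub> t)) =
          as_cochain G c (single s) \<otimes>\<^bsub>A\<^esub> \<rho> s (as_cochain G c (single t))"
        unfolding as_cochain_single[OF st(1)] as_cochain_single[OF st(2)]
          as_cochain_single[OF G.m_closed[OF st]] .
    qed
  qed
  ultimately show ?thesis
    using range unfolding cocycles_def kernel_def by (simp add: cochains_def)
qed

text \<open>The gain in regularity. Pulling back along the holomorphic map \<open>single\<close>
  turns a neighbourhood of the identity tuple into one of the identity of \<open>G\<close>, from
  where \<open>crossed_hom_holomorphic\<close> carries holomorphy to every point.\<close>

lemma cocycle_as_cochain:
  assumes f: "f \<in> carrier (cocycles G A \<rho> 1)"
  shows "(\<lambda>x\<in>carrier G. f (single x)) \<in> carrier (holomorphic_crossed_homs G A \<rho>)"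
proof -
  have f1: "f \<in> tuples G 1 \<rightarrow> carrier A" and loc: "locally_holomorphic_at_one G A 1 f"
    and cob: "coboundary G A \<rho> 1 f = \<one>\<^bsub>cochains G A (1 + 1)\<^esub>"
    using f unfolding cocycles_def kernel_def by (auto simp: cochains_def)
  have crossed: "f (single (s \<otimes>\<^bsub>G\<^esub> t)) = f (single s) \<otimes>\<^bsub>A\<^esub> \<rho> s (f (single t))"
    if "s \<in> carrier G" "t \<in> carrier G" for s t
    using cob that unfolding cocycle_condition[OF f1] by blast
  obtain W where W: "single \<one>\<^bsub>G\<^esub> \<in> W" "holomorphic_map_on W (power_manifold (mfd G) 1) (mfd A) f"
    using loc unfolding locally_holomorphic_at_one_def by blast
  have "complex_manifold (mfd G)" using G by (simp add: complex_lie_group_def)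
  then have "holomorphic_map (mfd G) (power_manifold (mfd G) 1) single"
    by (intro holomorphic_map_tuple holomorphic_map_id)
  from holomorphic_map_on_compose[OF _ _ this[unfolded holomorphic_map_def] W(2)]
  have "holomorphic_map_on (carrier G \<inter> single -` W) (mfd G) (mfd A) (\<lambda>x. f (single x))"
    by (simp add: charted_power del: power_manifold_simps)
  then have "holomorphic_map (mfd G) (mfd A) (\<lambda>x. f (single x))"
    by (rule crossed_hom_holomorphic[rotated 3]) (use W(1) crossed f1 single_tuples in \<open>auto simp del: One_nat_def\<close>)
  then show ?thesis by (rule crossed_homI) (rule crossed)
qed

text \<open>Both groups multiply pointwise, and the inverse map is composition with
  \<open>single\<close>, restricted to \<open>carrier G\<close>.\<close>

lemma as_cochain_iso: "as_cochain G \<in> iso (holomorphic_crossed_homs G A \<rho>) (cocycles G A \<rho> 1)"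
  (is "_ \<in> iso ?Z ?C")
proof -
  have "as_cochain G (c \<otimes>\<^bsub>?Z\<^esub> c') = as_cochain G c \<otimes>\<^bsub>?C\<^esub> as_cochain G c'" for c c'
  proof -
    have "as_cochain G (c \<otimes>\<^bsub>?Z\<^esub> c') = (\<lambda>s\<in>tuples G 1. as_cochain G c s \<otimes>\<^bsub>A\<^esub> as_cochain G c' s)"
      unfolding as_cochain_def crossed_homs_simps(2)
    proof (rule restrict_ext)
      fix s assume "s \<in> tuples G 1"
      moreover from this have "s 0 \<in> carrier G" by (auto simp: tuples_def)
      ultimately show "(\<lambda>s\<in>carrier G. c s \<otimes>\<^bsub>A\<^esub> c' s) (s 0) =
          (\<lambda>s\<in>tuples G 1. c (s 0)) s \<otimes>\<^bsub>A\<^esub> (\<lambda>s\<in>tuples G 1. c' (s 0)) s" by simp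
    qed
    then show ?thesis by (simp add: cocycles_def cochains_def)
  qed
  then have hom: "as_cochain G \<in> hom ?Z ?C"
    using as_cochain_cocycle by (simp add: hom_def)
  have "bij_betw (as_cochain G) (carrier ?Z) (carrier ?C)"
  proof (rule bij_betwI[where g = "\<lambda>f. \<lambda>x\<in>carrier G. f (single x)"])
    show "as_cochain G \<in> carrier ?Z \<rightarrow> carrier ?C" using as_cochain_cocycle by blast
    show "(\<lambda>f. \<lambda>x\<in>carrier G. f (single x)) \<in> carrier ?C \<rightarrow> carrier ?Z"
      using cocycle_as_cochain by blast
  next
    fix c assume c: "c \<in> carrier ?Z"
    then have "c \<in> extensional (carrier G)" by (rule crossed_hom_extensional)
    then show "(\<lambda>x\<in>carrier G. as_cochain G c (single x)) = c"
      using as_cochain_single by (intro extensionalityI[where A = "carrier G"]) simp_all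
  next
    fix f assume "f \<in> carrier ?C"
    then have "f \<in> extensional (tuples G 1)"
      unfolding cocycles_def kernel_def by (simp add: cochains_def PiE_def)
    then show "as_cochain G (\<lambda>x\<in>carrier G. f (single x)) = f" by (rule as_cochain_of_single)
  qed
  with hom show ?thesis by (simp add: iso_def)
qed

text \<open>A 0-cochain amounts to its value \<open>f e\<close>, an arbitrary element of
  \<open>A\<close>. In its coboundary the middle product is empty and the last exponent is -1, which
  leaves the principal crossed homomorphism of \<open>f e\<close>.\<close>

lemma coboundaries_1: "coboundaries G A \<rho> 1 = as_cochain G ` principal_crossed_homs G A \<rho>"
proof -
  \<comment> \<open>The only 0-tuple: an extensional function on the empty set is
    \<open>undefined\<close> everywhere.\<close>
  define e :: "nat \<Rightarrow> 'g" where "e = (\<lambda>_. undefined)"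
  have tuples_0: "tuples G 0 = {e}" by (simp add: tuples_def e_def)
  have cob: "coboundary G A \<rho> 0 f = as_cochain G (\<lambda>s\<in>carrier G. \<rho> s (f e) \<otimes>\<^bsub>A\<^esub> inv\<^bsub>A\<^esub> f e)"
    if "f e \<in> carrier A" for f
    unfolding coboundary_def as_cochain_def
  proof (simp only: add_0, rule restrict_ext)
    fix s assume "s \<in> tuples G 1"
    then have "s 0 \<in> carrier G" by (auto simp: tuples_def)
    then show "\<rho> (s 0) (f (\<lambda>j\<in>{..<0}. s (Suc j))) \<otimes>\<^bsub>A\<^esub>
        (\<Otimes>\<^bsub>A\<^esub>i\<in>{1..0}. f (merge_at G 0 i s) [^]\<^bsub>A\<^esub> ((-1) ^ i :: int)) \<otimes>\<^bsub>A\<^esub>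
        f (restrict s {..<0}) [^]\<^bsub>A\<^esub> ((-1) ^ 1 :: int) =
        (\<lambda>s\<in>carrier G. \<rho> s (f e) \<otimes>\<^bsub>A\<^esub> inv\<^bsub>A\<^esub> f e) (s 0)"
      using that by (simp add: restrict_def A.int_pow_neg A.int_pow_1 flip: e_def)
  qed
  have range: "(\<lambda>f. f e) ` carrier (cochains G A 0) = carrier A"
  proof (intro equalityI subsetI)
    fix a assume "a \<in> carrier A"
    then have "(\<lambda>_\<in>tuples G 0. a) \<in> carrier (cochains G A 0)" "(\<lambda>_\<in>tuples G 0. a) e = a"
      by (simp_all add: cochains_def tuples_0)
    then show "a \<in> (\<lambda>f. f e) ` carrier (cochains G A 0)" by (metis (lifting) imageI)
  qed (auto simp: cochains_def tuples_0)
  have "coboundaries G A \<rho> 1 =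
      (\<lambda>f. as_cochain G (\<lambda>s\<in>carrier G. \<rho> s (f e) \<otimes>\<^bsub>A\<^esub> inv\<^bsub>A\<^esub> f e)) ` carrier (cochains G A 0)"
    unfolding coboundaries_def using range cob by (auto intro!: image_cong)
  also have "\<dots> = (\<lambda>a. as_cochain G (\<lambda>s\<in>carrier G. \<rho> s a \<otimes>\<^bsub>A\<^esub> inv\<^bsub>A\<^esub> a)) `
      (\<lambda>f. f e) ` carrier (cochains G A 0)"
    by (simp add: image_image)
  also have "\<dots> = as_cochain G ` principal_crossed_homs G A \<rho>"
    unfolding range principal_crossed_homs_def by auto
  finally show ?thesis .
qed

end

section \<open>Passage to the quotients\<close>

lemma iso_FactGroup_image:
  assumes "monoid G" and h: "h \<in> iso G H" and N: "N \<subseteq> carrier G"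
  shows "image h \<in> iso (G Mod N) (H Mod (h ` N))"
proof -
  interpret monoid G by fact
  have hom: "h (x \<otimes>\<^bsub>G\<^esub> y) = h x \<otimes>\<^bsub>H\<^esub> h y" if "x \<in> carrier G" "y \<in> carrier G" for x y
    using h that by (auto simp: iso_def hom_def)
  have onto: "h ` carrier G = carrier H" and inj: "inj_on h (carrier G)"
    using h by (auto simp: iso_def bij_betw_def)
  \<comment> \<open>A coset is a set product with a singleton, so this one identity handles both the
    images of cosets and the products of cosets.\<close>
  have mult: "h ` (X <#>\<^bsub>G\<^esub> Y) = h ` X <#>\<^bsub>H\<^esub> h ` Y" if "X \<subseteq> carrier G" "Y \<subseteq> carrier G" for X Y
  proof -
    have "h ` (X <#>\<^bsub>G\<^esub> Y) = (\<Union>x\<in>X. \<Union>y\<in>Y. {h (x \<otimes>\<^bsub>G\<^esub> y)})"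
      unfolding set_mult_def by blast
    also have "\<dots> = (\<Union>x\<in>X. \<Union>y\<in>Y. {h x \<otimes>\<^bsub>H\<^esub> h y})"
      using that hom by (intro SUP_cong refl) auto
    finally show ?thesis by (simp add: set_mult_def)
  qed
  have coset: "h ` (N #>\<^bsub>G\<^esub> a) = h ` N #>\<^bsub>H\<^esub> h a" if "a \<in> carrier G" for a
    using mult[OF N, of "{a}"] that by (simp add: r_coset_eq_set_mult)
  have sub: "X \<subseteq> carrier G" if X: "X \<in> carrier (G Mod N)" for X
  proof -
    obtain a where "a \<in> carrier G" "X = N #>\<^bsub>G\<^esub> a"
      using X unfolding carrier_FactGroup by blast
    then show ?thesis using N by (auto simp: r_coset_def)
  qed
  have image: "image h ` carrier (G Mod N) = carrier (H Mod (h ` N))"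
  proof -
    have "image h ` carrier (G Mod N) = (\<lambda>a. h ` (N #>\<^bsub>G\<^esub> a)) ` carrier G"
      by (simp only: carrier_FactGroup image_image)
    also have "\<dots> = (\<lambda>a. h ` N #>\<^bsub>H\<^esub> h a) ` carrier G"
      by (rule image_cong[OF refl coset])
    also have "\<dots> = (\<lambda>b. h ` N #>\<^bsub>H\<^esub> b) ` h ` carrier G"
      by (simp only: image_image)
    finally show ?thesis by (simp only: onto carrier_FactGroup)
  qed
  \<comment> \<open>Cosets are subsets of the carrier, on which \<open>h\<close> is injective, so
    they are recovered from their images.\<close>
  have "inj_on (image h) (carrier (G Mod N))"
    by (rule inj_onI) (simp add: inj_on_image_eq_iff[OF inj sub sub])
  moreover have "image h \<in> hom (G Mod N) (H Mod (h ` N))"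
  proof (rule homI)
    show "h ` X \<in> carrier (H Mod h ` N)" if "X \<in> carrier (G Mod N)" for X
      using image that by blast
    show "h ` (X \<otimes>\<^bsub>G Mod N\<^esub> Y) = h ` X \<otimes>\<^bsub>H Mod h ` N\<^esub> h ` Y"
      if "X \<in> carrier (G Mod N)" "Y \<in> carrier (G Mod N)" for X Y
      using mult[OF sub sub] that by simp
  qed
  ultimately show ?thesis using image by (simp add: iso_def bij_betw_def)
qed

text \<open>The first conjunct makes the source of the third a factor group; the second identifies
  crossed homomorphisms with cocycles before coboundaries are divided out.\<close>

theorem proposition1:
  fixes G :: "('g, 'i) lie_group" and A :: "('a, 'j) lie_group" and \<rho> :: "'g \<Rightarrow> 'a \<Rightarrow> 'a"
  assumes "complex_lie_group G" and "holomorphic_module G A \<rho>"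
  shows "principal_crossed_homs G A \<rho> \<lhd> holomorphic_crossed_homs G A \<rho> \<and>
    as_cochain G \<in> iso (holomorphic_crossed_homs G A \<rho>) (cocycles G A \<rho> 1) \<and>
    image (as_cochain G) \<in>
      iso (holomorphic_crossed_homs G A \<rho> Mod principal_crossed_homs G A \<rho>) (H_lhm G A \<rho> 1)"
proof (intro conjI)
  show normal: "principal_crossed_homs G A \<rho> \<lhd> holomorphic_crossed_homs G A \<rho>"
    by (rule principal_crossed_homs_normal[OF assms])
  show iso: "as_cochain G \<in> iso (holomorphic_crossed_homs G A \<rho>) (cocycles G A \<rho> 1)"
    by (rule as_cochain_iso[OF assms])
  have "principal_crossed_homs G A \<rho> \<subseteq> carrier (holomorphic_crossed_homs G A \<rho>)"
    by (rule subgroup.subset[OF normal_imp_subgroup[OF normal]])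
  then show "image (as_cochain G) \<in>
      iso (holomorphic_crossed_homs G A \<rho> Mod principal_crossed_homs G A \<rho>) (H_lhm G A \<rho> 1)"
    unfolding H_lhm_def coboundaries_1[OF assms]
    by (intro iso_FactGroup_image iso comm_group.axioms(1)[THEN comm_monoid.axioms(1)]
        crossed_homs_comm_group[OF assms])
qed

end
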